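(* Let $\Gamma=\Gamma(B)$ be the quiver of a cluster-tilted algebra of simply-laced Dynkin type $\Delta$, let $k$ be a vertex of $\Gamma$, and let $\Gamma'$ be the quiver obtained from $\Gamma$ by mutating at $k$. Then the map $\phi_{\mathrm{in}}^{\Psi}\colon D(\Gamma)\to D(\Gamma')$, $d_\alpha^\Psi\mapsto d_\alpha^{\Psi'}$ ($\alpha\in\Phi^+$), does not depend on the companion basis $\Psi$ for $\Gamma$. That is, if $\Psi$ and $\Omega$ are any two companion bases for $\Gamma$, then $\phi_{\mathrm{in}}^{\Psi}=\phi_{\mathrm{in}}^{\Omega}$.
   Context: Let $\Delta$ be a Dynkin diagram of type $A_n$, $D_n$, $E_6$, $E_7$ or $E_8$, with $n$ vertices. For a skew-symmetric integer matrix $B=(b_{xy})$ and an index $k$, the mutation of $B$ at $k$ is $B'=(b'_{xy})$ with $b'_{xy}=-b_{xy}$ if $x=k$ or $y=k$, and $b'_{xy}=b_{xy}+\frac{|b_{xk}|b_{ky}+b_{xk}|b_{ky}|}{2}$ otherwise; mutation equivalence means being connected by finitely many mutations. The Cartan counterpart of $B$ has diagonal entries $2$ and off-diagonal entries $-|b_{xy}|$. Fix a skew-symmetric integer matrix $B$, with rows and columns indexed by an $n$-element set $\Gamma_0$, which is an exchange matrix of the cluster algebra of type $\Delta$, i.e. $B$ is mutation equivalent to a matrix $B_0$ whose Cartan counterpart is the Cartan matrix of type $\Delta$. (All entries of $B$ then lie in $\{0,\pm1\}$.) Let $\Gamma=\Gamma(B)$ be the quiver with vertex set $\Gamma_0$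 and an arrow $x\to y$ whenever $b_{xy}>0$; these are exactly the quivers of the cluster-tilted algebras of type $\Delta$. The quiver obtained from $\Gamma$ by mutating at $k$ is $\Gamma'=\Gamma(B')$, where $B'$ is the mutation of $B$ at $k$; its vertex set $\Gamma_0'$ is identified with $\Gamma_0$. Let $V$ be a Euclidean space with positive definite symmetric bilinear form $(\;,\;)$, and let $\Phi\subseteq V$ be the root system of type $\Delta$ (spanning $V$), normalised so that $(\alpha,\alpha)=2$ for every root, with positive roots $\Phi^+$. For a root $\gamma$, $s_\gamma(v)=v-(v,\gamma)\gamma$. A quasi-Cartan companion of $B$ is a (here symmetric) integer matrix $A=(a_{xy})$ with $a_{xx}=2$ for all $x$ and $|a_{xy}|=|b_{xy}|$ for all $x\ne y$; it is positive if it is positive definite. A companion basis for $\Gamma(B)$ is a subset $\{\gamma_x:x\in\Gamma_0\}\subseteq\Phi$, indexed by the vertices, which is a $\mathbb Z$-basis of $\mathbb Z\Phi$ and is such that $A=((\gamma_x,\gamma_y))_{x,y}$ is a positive quasi-Cartan companion of $B$. For a companion basis $\Psi=\{\gamma_x\}$ and $\alpha=\sum_x c_x\gamma_x\in\Phi$ with $c_x\in\mathbb Z$, put $d_\alpha^\Psi=(|c_x|)_{x\in\Gamma_0}$. The set $\{d_\alpha^\Psi:\alpha\in\Phi^+\}$ is the same for every companion basis $\Psi$ for $\Gamma$ and is denoted $D(\Gamma)$ (likewise $D(\Gamma')$); moreover $d_\alpha^\Psi$ determines $\alpha\in\Phi^+$ uniquely. The companion basis $\Psi'=\{\gamma_x':x\in\Gamma_0'\}$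 for $\Gamma'$ obtained from $\Psi$ by mutating inwardly at $k$ is given by $\gamma_x'=s_{\gamma_k}(\gamma_x)$ if there is an arrow $x\to k$ in $\Gamma$, and $\gamma_x'=\gamma_x$ otherwise. Hence $\phi_{\mathrm{in}}^\Psi$ is a well-defined bijection for each companion basis $\Psi$. *)

theory Defs
  imports "HOL-Analysis.Analysis"
begin

section \<open>Simply-laced Dynkin types\<close>

datatype dynkin = A_type nat | D_type nat | E6 | E7 | E8

fun valid_type :: "dynkin \<Rightarrow> bool" where
  "valid_type (A_type n) \<longleftrightarrow> 1 \<le> n"
| "valid_type (D_type n) \<longleftrightarrow> 4 \<le> n"
| "valid_type _ \<longleftrightarrow> True"

fun dynkin_rank :: "dynkin \<Rightarrow> nat" where
  "dynkin_rank (A_type n) = n"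
| "dynkin_rank (D_type n) = n"
| "dynkin_rank E6 = 6"
| "dynkin_rank E7 = 7"
| "dynkin_rank E8 = 8"

text \<open>Bourbaki numbering: the vertices are \<open>1, \<dots>, n\<close>.\<close>

definition E_edges :: "nat \<Rightarrow> nat set set" where
  "E_edges n = {{1, 3}, {2, 4}} \<union> {{i, i + 1} | i. 3 \<le> i \<and> i < n}"

fun dynkin_edges :: "dynkin \<Rightarrow> nat set set" where
  "dynkin_edges (A_type n) = {{i, i + 1} | i. 1 \<le> i \<and> i < n}"
| "dynkin_edges (D_type n) = {{i, i + 1} | i. 1 \<le> i \<and> i < n - 1} \<union> {{n - 2, n}}"
| "dynkin_edges E6 = E_edges 6"
| "dynkin_edges E7 = E_edges 7"
| "dynkin_edges E8 = E_edges 8"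

definition cartan_entry :: "dynkin \<Rightarrow> nat \<Rightarrow> nat \<Rightarrow> int" where
  "cartan_entry \<Delta> i j = (if i = j then 2 else if {i, j} \<in> dynkin_edges \<Delta> then - 1 else 0)"

text \<open>The matrix \<open>M\<close>, indexed by \<open>I\<close>, is the Cartan matrix of type \<open>\<Delta>\<close> up to a
  relabelling of the indices.\<close>

definition is_cartan_matrix_of_type :: "dynkin \<Rightarrow> 'i set \<Rightarrow> ('i \<Rightarrow> 'i \<Rightarrow> 'r::ring_1) \<Rightarrow> bool" where
  "is_cartan_matrix_of_type \<Delta> I M \<longleftrightarrow>
     (\<exists>\<sigma>. bij_betw \<sigma> {1..dynkin_rank \<Delta>} I \<and>
       (\<forall>i\<in>{1..dynkin_rank \<Delta>}. \<forall>j\<in>{1..dynkin_rank \<Delta>}. M (\<sigma> i) (\<sigma> j) = of_int (cartan_entry \<Delta> i j)))"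

section \<open>Exchange matrices, mutation and quivers\<close>

definition skew_symmetric :: "int ^ 'v ^ 'v \<Rightarrow> bool" where
  "skew_symmetric B \<longleftrightarrow> transpose B = - B"

text \<open>The division by 2 is exact: the numerator is \<open>0\<close> or \<open>\<plusminus> 2 b\<^sub>x\<^sub>k b\<^sub>k\<^sub>y\<close>.\<close>

definition mutation :: "'v \<Rightarrow> int ^ 'v ^ 'v \<Rightarrow> int ^ 'v ^ 'v" where
  "mutation k B = (\<chi> x y.
     if x = k \<or> y = k then - B $ x $ y
     else B $ x $ y + (\<bar>B $ x $ k\<bar> * B $ k $ y + B $ x $ k * \<bar>B $ k $ y\<bar>) div 2)"

definition mutation_equivalent :: "int ^ 'v ^ 'v \<Rightarrow> int ^ 'v ^ 'v \<Rightarrow> bool" where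
  "mutation_equivalent = (\<lambda>B B'. \<exists>k. B' = mutation k B)\<^sup>*\<^sup>*"

definition cartan_counterpart :: "int ^ 'v ^ 'v \<Rightarrow> int ^ 'v ^ 'v" where
  "cartan_counterpart B = (\<chi> x y. if x = y then 2 else - \<bar>B $ x $ y\<bar>)"

definition exchange_matrix_of_type :: "dynkin \<Rightarrow> int ^ 'v ^ 'v \<Rightarrow> bool" where
  "exchange_matrix_of_type \<Delta> B \<longleftrightarrow> skew_symmetric B \<and>
     (\<exists>B0. mutation_equivalent B B0 \<and>
       is_cartan_matrix_of_type \<Delta> UNIV (\<lambda>x y. cartan_counterpart B0 $ x $ y))"

text \<open>The quiver \<open>\<Gamma>(B)\<close> on the vertex set \<open>UNIV\<close>, as its set of arrows (source, target).\<close>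

definition quiver :: "int ^ 'v ^ 'v \<Rightarrow> ('v \<times> 'v) set" where
  "quiver B = {(x, y). B $ x $ y > 0}"

section \<open>Root systems\<close>

definition reflection :: "'a::real_inner \<Rightarrow> 'a \<Rightarrow> 'a" where
  "reflection \<gamma> v = v - (v \<bullet> \<gamma>) *\<^sub>R \<gamma>"

text \<open>All roots have square length 2, so that \<^const>\<open>reflection\<close> is the usual reflection,
  \<open>\<beta> \<bullet> \<alpha>\<close> is the Cartan integer of \<open>\<beta>\<close> and \<open>\<alpha>\<close>, and the root system is reduced.\<close>

definition normalised_root_system :: "'a::euclidean_space set \<Rightarrow> bool" where
  "normalised_root_system \<Phi> \<longleftrightarrow>
     finite \<Phi> \<and> span \<Phi> = UNIV \<and>
     (\<forall>\<alpha>\<in>\<Phi>. \<alpha> \<bullet> \<alpha> = 2) \<and>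
     (\<forall>\<alpha>\<in>\<Phi>. \<forall>\<beta>\<in>\<Phi>. reflection \<alpha> \<beta> \<in> \<Phi>) \<and>
     (\<forall>\<alpha>\<in>\<Phi>. \<forall>\<beta>\<in>\<Phi>. \<beta> \<bullet> \<alpha> \<in> \<int>)"

definition positive_roots :: "'a::euclidean_space set \<Rightarrow> 'a set \<Rightarrow> 'a set" where
  "positive_roots \<Phi> S = {\<alpha>\<in>\<Phi>. \<exists>c::'a \<Rightarrow> nat. \<alpha> = (\<Sum>b\<in>S. real (c b) *\<^sub>R b)}"

definition simple_system :: "'a::euclidean_space set \<Rightarrow> 'a set \<Rightarrow> bool" where
  "simple_system \<Phi> S \<longleftrightarrow> S \<subseteq> \<Phi> \<and> independent S \<and> span S = UNIV \<and>
     (\<forall>\<alpha>\<in>\<Phi>. \<alpha> \<in> positive_roots \<Phi> S \<or> - \<alpha> \<in> positive_roots \<Phi> S)"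

definition root_system_of_type :: "dynkin \<Rightarrow> 'a::euclidean_space set \<Rightarrow> 'a set \<Rightarrow> bool" where
  "root_system_of_type \<Delta> \<Phi> S \<longleftrightarrow> normalised_root_system \<Phi> \<and> simple_system \<Phi> S \<and>
     is_cartan_matrix_of_type \<Delta> S (\<lambda>\<alpha> \<beta>. \<alpha> \<bullet> \<beta>)"

section \<open>Companion bases\<close>

text \<open>The ambient vector space as a module over the integers: \<open>int_module.span \<Phi>\<close> is the root
  lattice, and \<open>int_module.representation\<close> gives integer coordinates.\<close>

global_interpretation int_module: module "\<lambda>(m::int) (v::'a::real_vector). real_of_int m *\<^sub>R v"
  by unfold_locales (simp_all add: algebra_simps)

definition quasi_cartan_companion :: "int ^ 'v ^ 'v \<Rightarrow> int ^ 'v ^ 'v \<Rightarrow> bool" where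
  "quasi_cartan_companion B A \<longleftrightarrow> transpose A = A \<and> (\<forall>x. A $ x $ x = 2) \<and>
     (\<forall>x y. x \<noteq> y \<longrightarrow> \<bar>A $ x $ y\<bar> = \<bar>B $ x $ y\<bar>)"

definition positive_matrix :: "int ^ 'v ^ 'v::finite \<Rightarrow> bool" where
  "positive_matrix A \<longleftrightarrow> (\<forall>u :: real ^ 'v. u \<noteq> 0 \<longrightarrow> u \<bullet> (map_matrix real_of_int A *v u) > 0)"

definition companion_basis ::
  "'a::euclidean_space set \<Rightarrow> int ^ 'v ^ 'v::finite \<Rightarrow> ('v \<Rightarrow> 'a) \<Rightarrow> bool" where
  "companion_basis \<Phi> B \<gamma> \<longleftrightarrow>
     range \<gamma> \<subseteq> \<Phi> \<and> inj \<gamma> \<and>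
     int_module.independent (range \<gamma>) \<and> int_module.span (range \<gamma>) = int_module.span \<Phi> \<and>
     (\<exists>A. (\<forall>x y. real_of_int (A $ x $ y) = \<gamma> x \<bullet> \<gamma> y) \<and>
          quasi_cartan_companion B A \<and> positive_matrix A)"

definition d_vector :: "('v \<Rightarrow> 'a::euclidean_space) \<Rightarrow> 'a \<Rightarrow> int ^ 'v::finite" where
  "d_vector \<gamma> \<alpha> = (\<chi> x. \<bar>int_module.representation (range \<gamma>) \<alpha> (\<gamma> x)\<bar>)"

text \<open>The set \<open>D(\<Gamma>)\<close> for \<open>\<Gamma> = \<Gamma>(B)\<close>. The set of d-vectors of a single companion basis does
  not depend on the basis, so the union over all companion bases is just this common set.\<close>

definition D_set ::
  "'a::euclidean_space set \<Rightarrow> 'a set \<Rightarrow> int ^ 'v ^ 'v::finite \<Rightarrow> (int ^ 'v) set" where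
  "D_set \<Phi> S B = (\<Union>\<gamma>\<in>{\<gamma>. companion_basis \<Phi> B \<gamma>}. d_vector \<gamma> ` positive_roots \<Phi> S)"

definition inward_mutation ::
  "int ^ 'v ^ 'v \<Rightarrow> 'v \<Rightarrow> ('v \<Rightarrow> 'a::euclidean_space) \<Rightarrow> ('v \<Rightarrow> 'a)" where
  "inward_mutation B k \<gamma> = (\<lambda>x. if (x, k) \<in> quiver B then reflection (\<gamma> k) (\<gamma> x) else \<gamma> x)"

text \<open>The map with domain \<open>D(\<Gamma>)\<close> sending the d-vector of a positive root \<open>\<alpha>\<close> with respect to
  \<open>\<gamma>\<close> to its d-vector with respect to the inwardly mutated basis; a positive root is determined
  by its d-vector. It is \<^const>\<open>undefined\<close> outside \<open>D(\<Gamma>)\<close>, so that equality of two such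
  maps is equality on \<open>D(\<Gamma>)\<close>.\<close>

definition phi_in ::
  "'a::euclidean_space set \<Rightarrow> 'a set \<Rightarrow> int ^ 'v ^ 'v::finite \<Rightarrow> 'v \<Rightarrow> ('v \<Rightarrow> 'a) \<Rightarrow>
     int ^ 'v \<Rightarrow> int ^ 'v" where
  "phi_in \<Phi> S B k \<gamma> = (\<lambda>d\<in>D_set \<Phi> S B.
     d_vector (inward_mutation B k \<gamma>) (THE \<alpha>. \<alpha> \<in> positive_roots \<Phi> S \<and> d_vector \<gamma> \<alpha> = d))"

end

theory Submission
  imports Defs
begin

text \<open>
  The map is independent of the companion basis because of a rigidity property. The Gram matrices of
  two companion bases \<open>\<Psi>\<close> and \<open>\<Omega>\<close> of \<open>B\<close> are
  positive definite and agree in absolute value, and two such matrices differ only by a simultaneous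
  change of signs of rows and columns (\<open>gram_companions_unique_up_to_signs\<close>). So there
  are signs \<open>\<epsilon>\<^sub>x\<close> and an isometry with \<open>\<Psi>\<^sub>x \<mapsto>
  \<epsilon>\<^sub>x \<Omega>\<^sub>x\<close>. It maps the root lattice to itself, hence also the
  set of lattice vectors of square length 2, and these are exactly the roots. It does not change the
  absolute values of coordinates, and it commutes with inward mutation up to signs, since the
  reflection in a root is also the reflection in its negative. Thus a positive root and its image
  (or the negative of the image) have the same d-vector before the mutation and the same d-vector
  after it (\<open>d_vector_transfer\<close>). As a d-vector determines the root up to sign
  (\<open>d_vector_inj_up_to_sign\<close>), the two maps coincide.

  That the values lie in \<open>D(\<Gamma>')\<close> means that the inwardly mutated family is a
  companion basis of the mutated matrix (\<open>companion_basis_inward_mutation\<close>). The only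
  delicate entries are those of adjacent vertices \<open>x\<close> and \<open>y\<close> with arrows
  \<open>x \<rightarrow> k \<rightarrow> y\<close>. There positivity makes the new inner product
  vanish, while the new entry of the exchange matrix vanishes exactly when the triangle
  \<open>x\<close>, \<open>k\<close>, \<open>y\<close> is an oriented cycle. Orientedness of
  triangles alone is not preserved by mutation; orientedness of all chordless cycles is, in the
  presence of a positive companion (\<open>cyclically_oriented_mutation\<close>). It holds for the
  matrix one starts from because a positive definite integral matrix with diagonal entries 2 and
  nonpositive entries elsewhere has no cycle in its graph, and it reaches \<open>B\<close> because
  mutation is an involution.

  One geometric device is used throughout: along an induced path, the sum of the vectors with
  suitable signs has again square length 2 (\<open>chain_signs_exist\<close>), and two independent
  vectors of square length 2 with integral inner product have inner product \<open>0\<close> or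
  \<open>\<plusminus> 1\<close>. A cycle is thereby contracted to a configuration of three vectors.
\<close>

section \<open>Vectors of square length two\<close>

lemma inner_bound_of_square_length_2:
  fixes u v :: "'a::real_inner"
  assumes "u \<bullet> u = 2" "v \<bullet> v = 2" "u \<in> span X" "v \<notin> span X"
  shows "\<bar>u \<bullet> v\<bar> < 2"
proof (rule ccontr)
  assume "\<not> \<bar>u \<bullet> v\<bar> < 2"
  then consider "u \<bullet> v \<ge> 2" | "u \<bullet> v \<le> - 2" by linarith
  then show False
  proof cases
    case 1
    have "(u - v) \<bullet> (u - v) \<le> 0"
      using 1 assms by (simp add: inner_diff_left inner_diff_right inner_commute)
    then have "u = v" by (metis inner_gt_zero_iff not_le right_minus_eq)
    then show False using assms by simp
  next
    case 2
    have "(u + v) \<bullet> (u + v) \<le> 0"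
      using 2 assms by (simp add: inner_add_left inner_add_right inner_commute)
    then have "v = - u" by (metis inner_gt_zero_iff not_le add_eq_0_iff)
    then show False using assms by (simp add: span_neg)
  qed
qed

text \<open>If the product were \<open>- 1\<close>, then \<open>v\<close> would agree with the
  combination of \<open>q\<close> and \<open>r\<close> that has the same inner products with
  \<open>q\<close> and \<open>r\<close>, because the difference has square length 0.\<close>

lemma triangle_product:
  fixes q r v :: "'a::real_inner"
  assumes "q \<bullet> q = 2" "r \<bullet> r = 2" "v \<bullet> v = 2" "q \<in> span X" "r \<in> span X" "v \<notin> span X"
    and abs: "\<bar>q \<bullet> r\<bar> = 1" "\<bar>q \<bullet> v\<bar> = 1" "\<bar>r \<bullet> v\<bar> = 1"
  shows "(q \<bullet> r) * (q \<bullet> v) * (r \<bullet> v) = 1"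
proof (rule ccontr)
  assume ne: "(q \<bullet> r) * (q \<bullet> v) * (r \<bullet> v) \<noteq> 1"
  define w where "w = (q \<bullet> v) *\<^sub>R q + (r \<bullet> v) *\<^sub>R r"
  have cases: "q \<bullet> r = 1 \<or> q \<bullet> r = - 1" "q \<bullet> v = 1 \<or> q \<bullet> v = - 1" "r \<bullet> v = 1 \<or> r \<bullet> v = - 1"
    using abs by linarith+
  have "(v - w) \<bullet> (v - w) = 0"
    using ne cases assms(1-3) unfolding w_def
    by (auto simp: inner_diff_left inner_diff_right inner_add_left inner_add_right inner_commute)
  then have "v = w" by simp
  moreover have "w \<in> span X"
    unfolding w_def by (intro span_add span_scale assms)
  ultimately show False using assms by simp
qed

definition chain_sum :: "(nat \<Rightarrow> real) \<Rightarrow> (nat \<Rightarrow> 'a::real_vector) \<Rightarrow> nat \<Rightarrow> nat \<Rightarrow> 'a" where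
  "chain_sum \<epsilon> v i j = (\<Sum>t\<in>{i..j}. \<epsilon> t *\<^sub>R v t)"

lemma chain_sum_inner: "chain_sum \<epsilon> v i j \<bullet> w = (\<Sum>t\<in>{i..j}. \<epsilon> t * (v t \<bullet> w))"
  by (simp add: chain_sum_def inner_sum_left)

lemma chain_sum_in_span:
  assumes "\<And>t. i \<le> t \<Longrightarrow> t \<le> j \<Longrightarrow> v t \<in> span X"
  shows "chain_sum \<epsilon> v i j \<in> span X"
  unfolding chain_sum_def by (intro span_sum span_scale) (use assms in auto)

text \<open>The signs are chosen so that consecutive summands of a signed chain have inner product
  \<open>- 1\<close>. The recursion is part of the definition because it fixes the signs once the
  inner products are known.\<close>

definition chain_signs :: "(nat \<Rightarrow> real) \<Rightarrow> (nat \<Rightarrow> 'a::real_inner) \<Rightarrow> nat \<Rightarrow> bool" where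
  "chain_signs \<epsilon> v n \<longleftrightarrow> (\<forall>t\<le>n. \<bar>\<epsilon> t\<bar> = 1) \<and>
     (\<forall>t. \<epsilon> (Suc t) = - \<epsilon> t * (v t \<bullet> v (Suc t))) \<and>
     (\<forall>i j. i \<le> j \<longrightarrow> j \<le> n \<longrightarrow> chain_sum \<epsilon> v i j \<bullet> chain_sum \<epsilon> v i j = 2)"

lemma chain_signsD:
  assumes "chain_signs \<epsilon> v n"
  shows "t \<le> n \<Longrightarrow> \<bar>\<epsilon> t\<bar> = 1" "\<epsilon> (Suc t) = - \<epsilon> t * (v t \<bullet> v (Suc t))"
    and "i \<le> j \<Longrightarrow> j \<le> n \<Longrightarrow> chain_sum \<epsilon> v i j \<bullet> chain_sum \<epsilon> v i j = 2"
  using assms unfolding chain_signs_def by blast+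

text \<open>Each new summand adds 2 to the square length and its inner product with the preceding
  summand, which occurs twice, takes 2 away.\<close>

lemma chain_signs_exist:
  fixes v :: "nat \<Rightarrow> 'a::real_inner"
  assumes norm: "\<And>t. t \<le> n \<Longrightarrow> v t \<bullet> v t = 2"
    and near: "\<And>t. t < n \<Longrightarrow> \<bar>v t \<bullet> v (Suc t)\<bar> = 1"
    and far: "\<And>s t. Suc s < t \<Longrightarrow> t \<le> n \<Longrightarrow> v s \<bullet> v t = 0"
  shows "\<exists>\<epsilon>. chain_signs \<epsilon> v n"
proof -
  define \<epsilon> where "\<epsilon> = rec_nat 1 (\<lambda>t e. - e * (v t \<bullet> v (Suc t)))"
  have Suc: "\<epsilon> (Suc t) = - \<epsilon> t * (v t \<bullet> v (Suc t))" for t by (simp add: \<epsilon>_def)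
  have abs: "t \<le> n \<Longrightarrow> \<bar>\<epsilon> t\<bar> = 1" for t
  proof (induction t)
    case 0 then show ?case by (simp add: \<epsilon>_def)
  next
    case (Suc t) then show ?case by (simp add: \<open>\<And>t. \<epsilon> (Suc t) = _\<close> abs_mult near)
  qed
  have sq: "t \<le> n \<Longrightarrow> \<epsilon> t * \<epsilon> t = 1" for t
    using abs[of t] by (metis abs_mult_self_eq mult_1)
  have "chain_sum \<epsilon> v i j \<bullet> chain_sum \<epsilon> v i j = 2" if "i \<le> j" "j \<le> n" for i j
    using that
  proof (induction j rule: dec_induct)
    case base
    then show ?case using sq[of i] norm[of i] by (simp add: chain_sum_def)
  next
    case (step j)
    have split: "chain_sum \<epsilon> v i (Suc j) = chain_sum \<epsilon> v i j + \<epsilon> (Suc j) *\<^sub>R v (Suc j)"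
      using step by (simp add: chain_sum_def)
    have "chain_sum \<epsilon> v i j \<bullet> v (Suc j) = (\<Sum>t\<in>{j}. \<epsilon> t * (v t \<bullet> v (Suc j)))"
      unfolding chain_sum_inner
      by (rule sum.mono_neutral_right) (use step far in \<open>auto simp: less_Suc_eq_le\<close>)
    then have cross: "chain_sum \<epsilon> v i j \<bullet> v (Suc j) = \<epsilon> j * (v j \<bullet> v (Suc j))" by simp
    have "\<epsilon> (Suc j) * (\<epsilon> j * (v j \<bullet> v (Suc j))) = - (\<epsilon> (Suc j) * \<epsilon> (Suc j))"
      by (simp add: Suc)
    then have "\<epsilon> (Suc j) * (chain_sum \<epsilon> v i j \<bullet> v (Suc j)) = - 1"
      using sq[of "Suc j"] step cross by simp
    then show ?case
      using step norm[of "Suc j"] sq[of "Suc j"] unfolding split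
      by (simp add: inner_add_left inner_add_right inner_commute)
  qed
  with abs Suc have "chain_signs \<epsilon> v n" unfolding chain_signs_def by blast
  then show ?thesis by blast
qed

section \<open>Gram companions\<close>

text \<open>This is the metric content of a companion basis, separated from the root system and its
  lattice: independent vectors whose Gram matrix is a positive quasi-Cartan companion of
  \<open>B\<close>. Independence is stated with coefficients indexed by the vertices, so that it
  contains injectivity.\<close>

definition gram_companion :: "int ^ 'v ^ 'v::finite \<Rightarrow> ('v \<Rightarrow> 'a::real_inner) \<Rightarrow> bool" where
  "gram_companion B g \<longleftrightarrow>
     (\<forall>c. (\<Sum>x\<in>UNIV. c x *\<^sub>R g x) = 0 \<longrightarrow> (\<forall>x. c x = 0)) \<and> (\<forall>x. g x \<bullet> g x = 2) \<and>
     (\<forall>x y. x \<noteq> y \<longrightarrow> \<bar>g x \<bullet> g y\<bar> = \<bar>real_of_int (B $ x $ y)\<bar>)"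

context
  fixes B :: "int ^ 'v ^ 'v::finite" and g :: "'v \<Rightarrow> 'a::real_inner"
  assumes g: "gram_companion B g"
begin

lemma gram_companion_coeffs: "(\<Sum>x\<in>UNIV. c x *\<^sub>R g x) = 0 \<Longrightarrow> c x = 0"
  using g by (auto simp: gram_companion_def)

lemma gram_companion_norm: "g x \<bullet> g x = 2"
  using g by (auto simp: gram_companion_def)

lemma gram_companion_abs: "x \<noteq> y \<Longrightarrow> \<bar>g x \<bullet> g y\<bar> = \<bar>real_of_int (B $ x $ y)\<bar>"
  using g by (auto simp: gram_companion_def)

lemma gram_companion_inj: "inj g"
proof (rule injI, rule ccontr)
  fix x y assume eq: "g x = g y" and ne: "x \<noteq> y"
  define c where "c z = (if z = x then 1 else if z = y then - 1 else 0 :: real)" for z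
  have "(\<Sum>z\<in>UNIV. c z *\<^sub>R g z)
      = (\<Sum>z\<in>UNIV. (if z = x then g x else 0) - (if z = y then g y else 0))"
    by (rule sum.cong) (use ne in \<open>auto simp: c_def\<close>)
  also have "\<dots> = 0" using eq by (simp add: sum_subtractf)
  finally have "c x = 0" by (rule gram_companion_coeffs)
  then show False by (simp add: c_def)
qed

lemma gram_companion_independent: "independent (range g)"
proof (rule independent_if_scalars_zero)
  fix f :: "'a \<Rightarrow> real" and v
  assume 0: "(\<Sum>x\<in>range g. f x *\<^sub>R x) = 0" and "v \<in> range g"
  then obtain x where x: "v = g x" by auto
  have "(\<Sum>x\<in>UNIV. f (g x) *\<^sub>R g x) = 0"
    using 0 by (simp add: sum.reindex[OF gram_companion_inj])
  from gram_companion_coeffs[OF this] show "f v = 0" by (simp add: x)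
qed simp

lemma gram_companion_notin_span: "x \<notin> X \<Longrightarrow> g x \<notin> span (g ` X)"
proof
  assume "x \<notin> X" "g x \<in> span (g ` X)"
  moreover have "g ` X \<subseteq> range g - {g x}"
    using \<open>x \<notin> X\<close> gram_companion_inj by (auto dest: injD)
  ultimately show False
    using gram_companion_independent span_mono unfolding dependent_def by blast
qed

lemma gram_companion_entry_le_1: "x \<noteq> y \<Longrightarrow> \<bar>B $ x $ y\<bar> \<le> 1"
proof -
  assume "x \<noteq> y"
  have "\<bar>g x \<bullet> g y\<bar> < 2"
  proof (rule inner_bound_of_square_length_2[OF gram_companion_norm gram_companion_norm])
    show "g x \<in> span (g ` {x})" by (simp add: span_base)
    show "g y \<notin> span (g ` {x})" by (rule gram_companion_notin_span) (use \<open>x \<noteq> y\<close> in simp)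
  qed
  then have "\<bar>real_of_int (B $ x $ y)\<bar> < 2"
    using gram_companion_abs[OF \<open>x \<noteq> y\<close>] by simp
  then show ?thesis by linarith
qed

lemma gram_companion_inner_eq_0: "x \<noteq> y \<Longrightarrow> B $ x $ y = 0 \<Longrightarrow> g x \<bullet> g y = 0"
  using gram_companion_abs[of x y] by simp

lemma gram_companion_inner_abs_1: "x \<noteq> y \<Longrightarrow> B $ x $ y \<noteq> 0 \<Longrightarrow> \<bar>g x \<bullet> g y\<bar> = 1"
proof -
  assume "x \<noteq> y" "B $ x $ y \<noteq> 0"
  then have "B $ x $ y = 1 \<or> B $ x $ y = - 1" using gram_companion_entry_le_1[of x y] by linarith
  then have "\<bar>real_of_int (B $ x $ y)\<bar> = 1" by auto
  with gram_companion_abs[OF \<open>x \<noteq> y\<close>] show "\<bar>g x \<bullet> g y\<bar> = 1" by (rule trans)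
qed

lemma gram_companion_triangle:
  assumes "x \<noteq> y" "y \<noteq> z" "x \<noteq> z" "B $ x $ y \<noteq> 0" "B $ y $ z \<noteq> 0" "B $ x $ z \<noteq> 0"
  shows "(g x \<bullet> g y) * (g x \<bullet> g z) * (g y \<bullet> g z) = 1"
proof (rule triangle_product)
  show "g z \<notin> span (g ` {x, y})" by (rule gram_companion_notin_span) (use assms in simp)
  show "g x \<in> span (g ` {x, y})" "g y \<in> span (g ` {x, y})" by (rule span_base, simp)+
  show "\<bar>g x \<bullet> g y\<bar> = 1" "\<bar>g x \<bullet> g z\<bar> = 1" "\<bar>g y \<bullet> g z\<bar> = 1"
    by (rule gram_companion_inner_abs_1; fact)+
qed (rule gram_companion_norm)+

end

section \<open>Cyclic orientation\<close>

text \<open>A walk from \<open>x\<close> to \<open>y\<close>, all of whose interior vertices are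
  different from \<open>z\<close> and not adjacent to \<open>z\<close>. For two distinct neighbours
  \<open>x\<close> and \<open>y\<close> of \<open>z\<close>, a shortest such walk closes up through
  \<open>z\<close> to a chordless cycle, and every chordless cycle through \<open>z\<close> arises in
  this way. Walks instead of cycles have the advantage that they may be prolonged and rerouted without
  any care for chords.\<close>

definition linked :: "int ^ 'v ^ 'v \<Rightarrow> 'v \<Rightarrow> 'v \<Rightarrow> 'v \<Rightarrow> bool" where
  "linked B z x y = (\<lambda>u v. B $ u $ v \<noteq> 0 \<and> (u = x \<or> u \<noteq> z \<and> B $ u $ z = 0) \<and>
     (v = y \<or> v \<noteq> z \<and> B $ v $ z = 0))\<^sup>*\<^sup>* x y"

text \<open>For entries in \<open>{0, 1, - 1}\<close> this says that at every vertex
  \<open>z\<close> of a chordless cycle one of the two arrows of the cycle enters \<open>z\<close> and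
  the other one leaves it: all chordless cycles, triangles included, are oriented.\<close>

definition cyclically_oriented :: "int ^ 'v ^ 'v \<Rightarrow> bool" where
  "cyclically_oriented B \<longleftrightarrow> (\<forall>z x y. x \<noteq> y \<longrightarrow> B $ x $ z \<noteq> 0 \<longrightarrow> B $ y $ z \<noteq> 0 \<longrightarrow>
     linked B z x y \<longrightarrow> B $ x $ z = - B $ y $ z)"

lemma cyclically_orientedD:
  "cyclically_oriented B \<Longrightarrow> x \<noteq> y \<Longrightarrow> B $ x $ z \<noteq> 0 \<Longrightarrow> B $ y $ z \<noteq> 0 \<Longrightarrow> linked B z x y \<Longrightarrow>
     B $ x $ z = - B $ y $ z"
  unfolding cyclically_oriented_def by blast

lemma skew_entry: "skew_symmetric B \<Longrightarrow> B $ x $ y = - B $ y $ x"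
proof -
  assume "skew_symmetric B"
  then have "transpose B $ y $ x = (- B) $ y $ x" by (simp only: skew_symmetric_def)
  then show "B $ x $ y = - B $ y $ x" by (simp add: transpose_def)
qed

lemma skew_diag: "skew_symmetric B \<Longrightarrow> B $ x $ x = 0"
  using skew_entry[of B x x] by linarith

lemma skew_zero: "skew_symmetric B \<Longrightarrow> B $ x $ y = 0 \<longleftrightarrow> B $ y $ x = 0"
  using skew_entry[of B x y] by linarith

lemma linked_sym:
  assumes "skew_symmetric B" "linked B z x y" shows "linked B z y x"
proof -
  let ?R = "\<lambda>x y u v. B $ u $ v \<noteq> 0 \<and> (u = x \<or> u \<noteq> z \<and> B $ u $ z = 0) \<and>
     (v = y \<or> v \<noteq> z \<and> B $ v $ z = 0)"
  have "(?R x y)\<inverse>\<inverse> = ?R y x"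
  proof (intro ext)
    fix u v show "(?R x y)\<inverse>\<inverse> u v = ?R y x u v"
      unfolding conversep_iff using skew_zero[OF assms(1), of u v] by blast
  qed
  with rtranclp_converseI[OF assms(2)[unfolded linked_def]] show ?thesis
    unfolding linked_def by (rule subst[rotated])
qed

lemma linked_path:
  assumes "i \<le> j" "\<And>t. i \<le> t \<Longrightarrow> t < j \<Longrightarrow> B $ p t $ p (Suc t) \<noteq> 0"
    and "\<And>t. i < t \<Longrightarrow> t < j \<Longrightarrow> p t \<noteq> z \<and> B $ p t $ z = 0"
  shows "linked B z (p i) (p j)"
  unfolding linked_def rtranclp_power relpowp_fun_conv
proof (rule exI[of _ "j - i"], rule exI[of _ "\<lambda>t. p (i + t)"], intro conjI allI impI)
  let ?f = "\<lambda>t. p (i + t)"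
  show "?f 0 = p i" "?f (j - i) = p j" using assms(1) by simp_all
  fix t assume t: "t < j - i"
  show "B $ ?f t $ ?f (Suc t) \<noteq> 0" using assms(2)[of "i + t"] t by simp
  show "?f t = p i \<or> ?f t \<noteq> z \<and> B $ ?f t $ z = 0" using assms(3)[of "i + t"] t by (cases "t = 0") simp_all
  show "?f (Suc t) = p j \<or> ?f (Suc t) \<noteq> z \<and> B $ ?f (Suc t) $ z = 0"
    using assms(3)[of "i + Suc t"] t by (cases "Suc t = j - i") simp_all
qed

lemma cyclically_oriented_triangle:
  assumes "cyclically_oriented B" "x \<noteq> y" "B $ x $ z \<noteq> 0" "B $ y $ z \<noteq> 0" "B $ x $ y \<noteq> 0"
  shows "B $ x $ z = - B $ y $ z"
proof (rule cyclically_orientedD[OF assms(1-4)])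
  show "linked B z x y" unfolding linked_def by (rule r_into_rtranclp) (use assms(5) in simp)
qed

definition shortest_path :: "('b \<Rightarrow> 'b \<Rightarrow> bool) \<Rightarrow> 'b \<Rightarrow> 'b \<Rightarrow> nat \<Rightarrow> (nat \<Rightarrow> 'b) \<Rightarrow> bool" where
  "shortest_path R x y n p \<longleftrightarrow> p 0 = x \<and> p n = y \<and> (\<forall>i<n. R (p i) (p (Suc i))) \<and>
     (\<forall>i j. i < j \<longrightarrow> j \<le> n \<longrightarrow> R (p i) (p j) \<longrightarrow> j = Suc i) \<and>
     (\<forall>i j. i < j \<longrightarrow> j \<le> n \<longrightarrow> p i \<noteq> p j)"

lemma rtranclp_shortest_path:
  assumes "R\<^sup>*\<^sup>* x y"
  obtains n p where "shortest_path R x y n p"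
proof -
  define n where "n = (LEAST n. (R ^^ n) x y)"
  have "\<exists>n. (R ^^ n) x y" using assms by (simp add: rtranclp_power)
  then have n: "(R ^^ n) x y" unfolding n_def by (rule LeastI_ex)
  have least: "(R ^^ m) x y \<Longrightarrow> n \<le> m" for m unfolding n_def by (rule Least_le)
  obtain p where p: "p 0 = x" "p n = y" "\<forall>i<n. R (p i) (p (Suc i))"
    using n unfolding relpowp_fun_conv by blast
  have pre: "(R ^^ i) x (p i)" if "i \<le> n" for i
    unfolding relpowp_fun_conv using p that by (intro exI[of _ p]) auto
  have post: "(R ^^ (n - i)) (p i) y" if "i \<le> n" for i
    unfolding relpowp_fun_conv using p that by (intro exI[of _ "\<lambda>t. p (i + t)"]) auto
  have "j = Suc i" if "i < j" "j \<le> n" "R (p i) (p j)" for i j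
  proof -
    have "(R ^^ Suc i) x (p j)" using pre[of i] that by (simp add: relcomppI)
    then have "(R ^^ (Suc i + (n - j))) x y"
      unfolding relpowp_add using post[OF that(2)] by (rule relcomppI)
    from least[OF this] that show ?thesis by linarith
  qed
  moreover have "p i \<noteq> p j" if "i < j" "j \<le> n" for i j
  proof
    assume "p i = p j"
    then have "(R ^^ i) x (p j)" using pre[of i] that by simp
    then have "(R ^^ (i + (n - j))) x y"
      unfolding relpowp_add using post[OF that(2)] by (rule relcomppI)
    from least[OF this] that show False by linarith
  qed
  ultimately have "shortest_path R x y n p" using p unfolding shortest_path_def by blast
  then show thesis by (rule that)
qed

text \<open>An induced path between two neighbours of \<open>z\<close> with no further neighbour of
  \<open>z\<close> on it; together with \<open>z\<close> it is a chordless cycle.\<close>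

definition induced_path :: "int ^ 'v ^ 'v \<Rightarrow> 'v \<Rightarrow> 'v \<Rightarrow> 'v \<Rightarrow> nat \<Rightarrow> (nat \<Rightarrow> 'v) \<Rightarrow> bool" where
  "induced_path B z x y n p \<longleftrightarrow> p 0 = x \<and> p n = y \<and> 0 < n \<and>
     (\<forall>i<n. B $ p i $ p (Suc i) \<noteq> 0) \<and>
     (\<forall>i j. Suc i < j \<longrightarrow> j \<le> n \<longrightarrow> B $ p i $ p j = 0) \<and>
     (\<forall>i j. i < j \<longrightarrow> j \<le> n \<longrightarrow> p i \<noteq> p j) \<and>
     (\<forall>i\<le>n. p i \<noteq> z) \<and> (\<forall>i. 0 < i \<longrightarrow> i < n \<longrightarrow> B $ p i $ z = 0)"

lemma induced_pathD:
  assumes "induced_path B z x y n p"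
  shows "p 0 = x" "p n = y" "0 < n"
    and "i < n \<Longrightarrow> B $ p i $ p (Suc i) \<noteq> 0"
    and "Suc i < j \<Longrightarrow> j \<le> n \<Longrightarrow> B $ p i $ p j = 0"
    and "i < j \<Longrightarrow> j \<le> n \<Longrightarrow> p i \<noteq> p j"
    and "i \<le> n \<Longrightarrow> p i \<noteq> z"
    and "0 < i \<Longrightarrow> i < n \<Longrightarrow> B $ p i $ z = 0"
  using assms unfolding induced_path_def by blast+

lemma linked_induced_path:
  assumes skew: "skew_symmetric B" and "linked B z x y" "x \<noteq> y" "B $ x $ z \<noteq> 0" "B $ y $ z \<noteq> 0"
  obtains n p where "induced_path B z x y n p"
proof -
  define R where "R u v \<longleftrightarrow> B $ u $ v \<noteq> 0 \<and> (u = x \<or> u \<noteq> z \<and> B $ u $ z = 0) \<and>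
    (v = y \<or> v \<noteq> z \<and> B $ v $ z = 0)" for u v
  have "R\<^sup>*\<^sup>* x y" using assms(2) by (simp add: linked_def R_def[abs_def])
  then obtain n p where "shortest_path R x y n p" by (rule rtranclp_shortest_path)
  then have p: "p 0 = x" "p n = y" and step: "\<forall>i<n. R (p i) (p (Suc i))"
    and chord: "\<forall>i j. i < j \<longrightarrow> j \<le> n \<longrightarrow> R (p i) (p j) \<longrightarrow> j = Suc i"
    and dist: "\<forall>i j. i < j \<longrightarrow> j \<le> n \<longrightarrow> p i \<noteq> p j"
    unfolding shortest_path_def by blast+
  have "0 < n" using p \<open>x \<noteq> y\<close> by (cases n) auto
  have xz: "x \<noteq> z" "y \<noteq> z" using assms(4,5) skew_diag[OF skew] by auto
  have inner: "B $ p i $ z = 0 \<and> p i \<noteq> z" if "0 < i" "i < n" for i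
  proof -
    have "R (p i) (p (Suc i))" "p i \<noteq> x" using step dist p that by (blast, force)
    then show ?thesis by (simp add: R_def)
  qed
  have nz: "p i \<noteq> z" if "i \<le> n" for i
    using inner[of i] that xz p by (cases "i = 0"; cases "i = n") simp_all
  have far: "B $ p i $ p j = 0" if "Suc i < j" "j \<le> n" for i j
  proof (rule ccontr)
    assume ne: "B $ p i $ p j \<noteq> 0"
    have "p i = x \<or> p i \<noteq> z \<and> B $ p i $ z = 0"
      using inner[of i] p that by (cases "i = 0") simp_all
    moreover have "p j = y \<or> p j \<noteq> z \<and> B $ p j $ z = 0"
      using inner[of j] p that by (cases "j = n") simp_all
    ultimately have "R (p i) (p j)" using ne by (simp add: R_def)
    then have "j = Suc i" using chord that by (meson Suc_lessD)
    then show False using that by simp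
  qed
  have "B $ p i $ p (Suc i) \<noteq> 0" if "i < n" for i using step that by (simp add: R_def)
  then have "induced_path B z x y n p"
    unfolding induced_path_def using p \<open>0 < n\<close> inner nz far dist by (intro conjI) simp_all
  then show thesis by (rule that)
qed

section \<open>Mutation of exchange matrices\<close>

lemma half_abs_product:
  fixes a b :: int
  shows "(\<bar>a\<bar> * b + a * \<bar>b\<bar>) div 2 =
    (if a > 0 \<and> b > 0 then a * b else if a < 0 \<and> b < 0 then - (a * b) else 0)"
proof -
  consider "a = 0 \<or> b = 0" | "a > 0" "b > 0" | "a > 0" "b < 0" | "a < 0" "b > 0" | "a < 0" "b < 0"
    by linarith
  then show ?thesis
  proof cases
    case 5
    then have "\<bar>a\<bar> * b + a * \<bar>b\<bar> = 2 * (- (a * b))" by simp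
    then have "(\<bar>a\<bar> * b + a * \<bar>b\<bar>) div 2 = - (a * b)" by simp
    with 5 show ?thesis by simp
  qed (auto simp flip: mult_2)
qed

lemma mutation_entry_k: "mutation k B $ k $ x = - B $ k $ x" "mutation k B $ x $ k = - B $ x $ k"
  by (simp_all add: mutation_def)

lemma mutation_entry_general:
  assumes "x \<noteq> k" "y \<noteq> k"
  shows "mutation k B $ x $ y = B $ x $ y +
    (if B $ x $ k > 0 \<and> B $ k $ y > 0 then B $ x $ k * B $ k $ y
     else if B $ x $ k < 0 \<and> B $ k $ y < 0 then - (B $ x $ k * B $ k $ y) else 0)"
  using assms by (simp add: mutation_def half_abs_product)

lemma mutation_entry:
  assumes "x \<noteq> k" "y \<noteq> k" "\<bar>B $ x $ k\<bar> \<le> 1" "\<bar>B $ k $ y\<bar> \<le> 1"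
  shows "mutation k B $ x $ y = B $ x $ y + (if B $ x $ k = B $ k $ y then B $ x $ k else 0)"
proof -
  have "B $ x $ k = - 1 \<or> B $ x $ k = 0 \<or> B $ x $ k = 1" "B $ k $ y = - 1 \<or> B $ k $ y = 0 \<or> B $ k $ y = 1"
    using assms(3,4) by linarith+
  then show ?thesis unfolding mutation_entry_general[OF assms(1,2)] by (elim disjE) simp_all
qed

lemma skew_symmetricI: "(\<And>x y. B $ x $ y = - B $ y $ x) \<Longrightarrow> skew_symmetric B"
proof -
  assume *: "\<And>x y. B $ x $ y = - B $ y $ x"
  show ?thesis unfolding skew_symmetric_def vec_eq_iff
  proof (intro allI)
    fix x y show "transpose B $ x $ y = (- B) $ x $ y" using *[of y x] by (simp add: transpose_def)
  qed
qed

lemma skew_symmetric_mutation: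
  assumes "skew_symmetric B"
  shows "skew_symmetric (mutation k B)"
proof (rule skew_symmetricI)
  fix x y
  show "mutation k B $ x $ y = - mutation k B $ y $ x"
  proof (cases "x = k \<or> y = k")
    case True
    then show ?thesis using skew_entry[OF assms, of x y] by (auto simp: mutation_entry_k)
  next
    case False
    then have ne: "x \<noteq> k" "y \<noteq> k" by auto
    show ?thesis
      unfolding mutation_entry_general[OF ne] mutation_entry_general[OF ne(2,1)]
        skew_entry[OF assms, of y x] skew_entry[OF assms, of k x] skew_entry[OF assms, of y k]
      by (simp add: mult.commute)
  qed
qed

lemma mutation_involution: "mutation k (mutation k B) = B"
  unfolding vec_eq_iff
proof (intro allI)
  fix x y
  show "mutation k (mutation k B) $ x $ y = B $ x $ y"
  proof (cases "x = k \<or> y = k")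
    case True
    then show ?thesis by (auto simp: mutation_entry_k)
  next
    case False
    then have ne: "x \<noteq> k" "y \<noteq> k" by auto
    show ?thesis
      unfolding mutation_entry_general[OF ne] mutation_entry_k by simp
  qed
qed

section \<open>Mutation of Gram companions\<close>

text \<open>Every vector changes by a multiple of \<open>g k\<close>, so the change of basis only affects the
  coordinate at \<open>k\<close>.\<close>

lemma inward_mutation_sum:
  fixes g :: "'v::finite \<Rightarrow> 'a::euclidean_space"
  shows "(\<Sum>x\<in>UNIV. c x *\<^sub>R inward_mutation B k g x)
    = (\<Sum>x\<in>UNIV. (c x - (if x = k then \<Sum>y | (y, k) \<in> quiver B. c y * (g y \<bullet> g k) else 0)) *\<^sub>R g x)"
proof -
  let ?s = "\<Sum>y | (y, k) \<in> quiver B. c y * (g y \<bullet> g k)"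
  have "(\<Sum>x\<in>UNIV. c x *\<^sub>R inward_mutation B k g x)
    = (\<Sum>x\<in>UNIV. c x *\<^sub>R g x - (if (x, k) \<in> quiver B then c x * (g x \<bullet> g k) else 0) *\<^sub>R g k)"
    by (rule sum.cong) (simp_all add: inward_mutation_def reflection_def algebra_simps)
  also have "\<dots> = (\<Sum>x\<in>UNIV. c x *\<^sub>R g x) - ?s *\<^sub>R g k"
    by (simp add: sum_subtractf sum.If_cases flip: scaleR_left.sum)
  also have "?s *\<^sub>R g k = (\<Sum>x\<in>UNIV. if x = k then ?s *\<^sub>R g x else 0)" by simp
  also have "\<dots> = (\<Sum>x\<in>UNIV. (if x = k then ?s else 0) *\<^sub>R g x)" by (rule sum.cong) simp_all
  finally show ?thesis by (simp only: sum_subtractf[symmetric] scaleR_left_diff_distrib)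
qed

text \<open>Two vertices that are both reflected, or both fixed, keep their inner product, and their
  entry of \<open>B\<close> keeps its absolute value. If only \<open>x\<close> is reflected, the inner
  product with \<open>y\<close> becomes \<open>g x \<bullet> g y - (g x \<bullet> g k) * (g y
  \<bullet> g k)\<close>. When \<open>x\<close>, \<open>y\<close>, \<open>k\<close> form a triangle
  this is 0 by positivity, and cyclic orientation makes the corresponding entry of the mutated matrix
  0 too.\<close>

lemma gram_companion_inward_mutation:
  fixes g :: "'v::finite \<Rightarrow> 'a::euclidean_space"
  assumes g: "gram_companion B g" and skew: "skew_symmetric B" and cyc: "cyclically_oriented B"
  shows "gram_companion (mutation k B) (inward_mutation B k g)"
proof -
  let ?g = "inward_mutation B k g" and ?B = "mutation k B"
  note norm = gram_companion_norm[OF g]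
  have diag: "B $ x $ x = 0" for x by (rule skew_diag[OF skew])
  have in_k: "?g k = g k" by (simp add: inward_mutation_def quiver_def diag)
  have le1: "\<bar>B $ x $ y\<bar> \<le> 1" for x y
    using gram_companion_entry_le_1[OF g, of x y] diag by (cases "x = y") simp_all
  have in_x: "?g x = (if B $ x $ k = 1 then g x - (g x \<bullet> g k) *\<^sub>R g k else g x)" for x
  proof -
    have "0 < B $ x $ k \<longleftrightarrow> B $ x $ k = 1" using le1[of x k] by linarith
    then show ?thesis by (simp add: inward_mutation_def quiver_def reflection_def)
  qed
  have coeffs: "c x = 0" if 0: "(\<Sum>x\<in>UNIV. c x *\<^sub>R ?g x) = 0" for c x
  proof -
    let ?s = "\<Sum>y | (y, k) \<in> quiver B. c y * (g y \<bullet> g k)"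
    have c: "c x - (if x = k then ?s else 0) = 0" for x
      by (rule gram_companion_coeffs[OF g 0[unfolded inward_mutation_sum]])
    have "c y = 0" if "(y, k) \<in> quiver B" for y
      using c[of y] that diag by (auto simp: quiver_def split: if_splits)
    then have "?s = 0" by simp
    with c[of x] show "c x = 0" by (simp split: if_splits)
  qed
  have norm': "?g x \<bullet> ?g x = 2" for x
    by (simp add: in_x norm inner_diff_left inner_diff_right inner_commute algebra_simps)
  have with_k: "\<bar>?g x \<bullet> ?g k\<bar> = \<bar>real_of_int (?B $ x $ k)\<bar>" if "x \<noteq> k" for x
    using gram_companion_abs[OF g that]
    by (simp add: in_k in_x[of x] norm inner_diff_left mutation_entry_k)
  have one_side: "\<bar>?g x \<bullet> ?g y\<bar> = \<bar>real_of_int (?B $ x $ y)\<bar>"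
    if ne: "x \<noteq> y" "x \<noteq> k" "y \<noteq> k" and xk: "B $ x $ k = 1" and yk: "B $ y $ k \<noteq> 1" for x y
  proof -
    have ky: "B $ k $ y = - B $ y $ k" by (rule skew_entry[OF skew])
    have inner: "?g x \<bullet> ?g y = g x \<bullet> g y - (g x \<bullet> g k) * (g y \<bullet> g k)"
      by (simp add: in_x xk yk inner_diff_left inner_commute[of "g y"])
    have entry: "?B $ x $ y = B $ x $ y + (if B $ y $ k = - 1 then 1 else 0)"
      using mutation_entry[OF ne(2,3) le1 le1] xk ky by simp
    consider "B $ y $ k = 0" | "B $ y $ k = - 1" "B $ x $ y = 0" | "B $ y $ k = - 1" "B $ x $ y \<noteq> 0"
      using le1[of y k] yk by linarith
    then show ?thesis
    proof cases
      case 1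
      then show ?thesis
        using gram_companion_abs[OF g ne(1)] gram_companion_inner_eq_0[OF g ne(3)]
        by (simp add: inner entry)
    next
      case 2
      have "\<bar>g x \<bullet> g k\<bar> = 1" "\<bar>g y \<bullet> g k\<bar> = 1"
        using gram_companion_inner_abs_1[OF g] ne 2 xk by simp_all
      then show ?thesis
        using gram_companion_inner_eq_0[OF g ne(1)] 2 by (simp add: inner entry abs_mult)
    next
      case 3
      have "(g x \<bullet> g y) * (g x \<bullet> g k) * (g y \<bullet> g k) = 1"
        using gram_companion_triangle[OF g ne(1) ne(3) ne(2)] 3 xk by simp
      moreover have "\<bar>g x \<bullet> g y\<bar> = 1" "\<bar>g x \<bullet> g k\<bar> = 1" "\<bar>g y \<bullet> g k\<bar> = 1"
        using gram_companion_inner_abs_1[OF g] ne 3 xk by simp_all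
      ultimately have "g x \<bullet> g y = (g x \<bullet> g k) * (g y \<bullet> g k)"
        by (auto simp: abs_if split: if_splits)
      moreover have "B $ x $ y = - B $ k $ y"
        using cyclically_oriented_triangle[OF cyc, of x k y] ne 3 xk ky by simp
      ultimately show ?thesis using ky 3 by (simp add: inner entry)
    qed
  qed
  have "\<bar>?g x \<bullet> ?g y\<bar> = \<bar>real_of_int (?B $ x $ y)\<bar>" if ne: "x \<noteq> y" for x y
  proof -
    have comm: "\<bar>?g x \<bullet> ?g y\<bar> = \<bar>?g y \<bullet> ?g x\<bar>" "\<bar>real_of_int (?B $ x $ y)\<bar> = \<bar>real_of_int (?B $ y $ x)\<bar>"
      using skew_entry[OF skew_symmetric_mutation[OF skew], of k x y] by (simp_all add: inner_commute)
    have ky: "B $ k $ y = - B $ y $ k" by (rule skew_entry[OF skew])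
    consider "x = k" | "y = k" | "x \<noteq> k" "y \<noteq> k" "B $ x $ k = 1" "B $ y $ k = 1"
      | "x \<noteq> k" "y \<noteq> k" "B $ x $ k = 1" "B $ y $ k \<noteq> 1"
      | "x \<noteq> k" "y \<noteq> k" "B $ x $ k \<noteq> 1" "B $ y $ k = 1"
      | "x \<noteq> k" "y \<noteq> k" "B $ x $ k \<noteq> 1" "B $ y $ k \<noteq> 1" by blast
    then show ?thesis
    proof cases
      case 1 then show ?thesis using comm with_k[of y] ne by simp
    next
      case 2 then show ?thesis using with_k[of x] ne by simp
    next
      case 3
      have "?g x \<bullet> ?g y = g x \<bullet> g y"
        by (simp add: in_x 3 norm inner_diff_left inner_diff_right inner_commute algebra_simps)
      moreover have "?B $ x $ y = B $ x $ y" using mutation_entry[OF 3(1,2) le1 le1] 3 ky by simp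
      ultimately show ?thesis using gram_companion_abs[OF g ne] by simp
    next
      case 4 then show ?thesis using one_side ne by simp
    next
      case 5 then show ?thesis using one_side[of y x] ne comm by simp
    next
      case 6
      have "?B $ x $ y = B $ x $ y"
        using mutation_entry[OF 6(1,2) le1 le1] 6 ky le1[of x k] le1[of y k] by (simp split: if_splits)
      then show ?thesis using gram_companion_abs[OF g ne] by (simp add: in_x 6)
    qed
  qed
  with coeffs norm' show ?thesis unfolding gram_companion_def by blast
qed

section \<open>Induced paths in Gram companions\<close>

lemma sum_only_one:
  fixes f :: "nat \<Rightarrow> real"
  assumes "i \<le> m" "m \<le> j" "\<And>t. i \<le> t \<Longrightarrow> t \<le> j \<Longrightarrow> t \<noteq> m \<Longrightarrow> f t = 0"
  shows "(\<Sum>t\<in>{i..j}. f t) = f m"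
proof -
  have "(\<Sum>t\<in>{i..j}. f t) = (\<Sum>t\<in>{m}. f t)"
    by (rule sum.mono_neutral_right) (use assms in auto)
  then show ?thesis by simp
qed

lemma sum_only_ends:
  fixes f :: "nat \<Rightarrow> real"
  assumes "i < j" "\<And>t. i < t \<Longrightarrow> t < j \<Longrightarrow> f t = 0"
  shows "(\<Sum>t\<in>{i..j}. f t) = f i + f j"
proof -
  have "(\<Sum>t\<in>{i..j}. f t) = (\<Sum>t\<in>{i,j}. f t)"
    by (rule sum.mono_neutral_right) (use assms in auto)
  then show ?thesis using assms by simp
qed

lemma induced_path_signs:
  assumes g: "gram_companion B g" and p: "induced_path B z x y n p"
  shows "\<exists>\<epsilon>. chain_signs \<epsilon> (\<lambda>t. g (p t)) n"
proof (rule chain_signs_exist)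
  show "g (p t) \<bullet> g (p t) = 2" for t by (rule gram_companion_norm[OF g])
  show "\<bar>g (p t) \<bullet> g (p (Suc t))\<bar> = 1" if "t < n" for t
    by (rule gram_companion_inner_abs_1[OF g])
       (use induced_pathD(4,6)[OF p, of t] that in \<open>auto\<close>)
  show "g (p s) \<bullet> g (p t) = 0" if "Suc s < t" "t \<le> n" for s t
    by (rule gram_companion_inner_eq_0[OF g])
       (use induced_pathD(5)[OF p that] induced_pathD(6)[OF p, of s t] that in auto)
qed

lemma induced_path_chain_in_span:
  assumes "\<And>t. t \<le> n \<Longrightarrow> p t \<noteq> w" "j \<le> n"
  shows "chain_sum \<epsilon> (\<lambda>t. g (p t)) i j \<in> span (g ` (- {w}))"
  by (rule chain_sum_in_span, rule span_base) (use assms in auto)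

lemma path_chain_inner_lt_2:
  assumes g: "gram_companion B g" and "\<And>t. t \<le> n \<Longrightarrow> p t \<noteq> w" "j \<le> n"
    and "chain_sum \<epsilon> (\<lambda>t. g (p t)) i j \<bullet> chain_sum \<epsilon> (\<lambda>t. g (p t)) i j = 2"
  shows "\<bar>chain_sum \<epsilon> (\<lambda>t. g (p t)) i j \<bullet> g w\<bar> < 2"
  by (rule inner_bound_of_square_length_2[OF assms(4) gram_companion_norm[OF g]
        induced_path_chain_in_span[OF assms(2,3)] gram_companion_notin_span[OF g]]) simp_all

text \<open>There are no chordless cycles at all: the vectors along an induced path closing up at
  \<open>z\<close> would add up to a vector of square length 2 having inner product \<open>- 2\<close>
  with \<open>g z\<close>. So the condition holds vacuously.\<close>

lemma cyclically_oriented_of_nonpositive_companion: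
  assumes g: "gram_companion B g" and skew: "skew_symmetric B"
    and nonpos: "\<And>x y. x \<noteq> y \<Longrightarrow> g x \<bullet> g y \<le> 0"
  shows "cyclically_oriented B"
  unfolding cyclically_oriented_def
proof (intro allI impI, rule ccontr)
  fix z x y
  assume xy: "x \<noteq> y" "B $ x $ z \<noteq> 0" "B $ y $ z \<noteq> 0" "linked B z x y"
  have neg: "g u \<bullet> g v = - 1" if "u \<noteq> v" "B $ u $ v \<noteq> 0" for u v
    using gram_companion_inner_abs_1[OF g that] nonpos[OF that(1)] by linarith
  obtain n p where p: "induced_path B z x y n p"
    by (rule linked_induced_path[OF skew xy(4,1,2,3)])
  note pD = induced_pathD[OF p]
  obtain \<epsilon> where \<epsilon>: "chain_signs \<epsilon> (\<lambda>t. g (p t)) n"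
    using induced_path_signs[OF g p] by blast
  note abs = chain_signsD(1)[OF \<epsilon>] and rec = chain_signsD(2)[OF \<epsilon>] and norm = chain_signsD(3)[OF \<epsilon>]
  have const: "t \<le> n \<Longrightarrow> \<epsilon> t = \<epsilon> 0" for t
  proof (induction t)
    case (Suc t)
    have "g (p t) \<bullet> g (p (Suc t)) = - 1"
      by (rule neg) (use pD(4,6)[of t] Suc in auto)
    then show ?case using Suc by (simp add: rec)
  qed simp
  have "chain_sum \<epsilon> (\<lambda>t. g (p t)) 0 n \<bullet> g z = \<epsilon> 0 * (g (p 0) \<bullet> g z) + \<epsilon> n * (g (p n) \<bullet> g z)"
    unfolding chain_sum_inner
  proof (rule sum_only_ends[OF pD(3)])
    fix t assume "0 < t" "t < n"
    then show "\<epsilon> t * (g (p t) \<bullet> g z) = 0"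
      using gram_companion_inner_eq_0[OF g pD(7) pD(8)] by simp
  qed
  also have "\<dots> = - 2 * \<epsilon> 0"
    using neg[of x z] neg[of y z] pD(7)[of 0] pD(7)[of n] xy pD(1,2) const[of n] by simp
  finally have "\<bar>chain_sum \<epsilon> (\<lambda>t. g (p t)) 0 n \<bullet> g z\<bar> = 2" using abs[of 0] by (simp add: abs_mult)
  moreover have "\<bar>chain_sum \<epsilon> (\<lambda>t. g (p t)) 0 n \<bullet> g z\<bar> < 2"
    by (rule path_chain_inner_lt_2[OF g pD(7) order_refl norm]) simp_all
  ultimately show False by simp
qed

text \<open>The vertex \<open>l\<close> and the path form a chordless cycle, and \<open>k\<close> is
  a hub, joined by spokes to \<open>l\<close> and to some vertices of the path, of which
  \<open>i0\<close> and \<open>i1\<close> are the first and the last position. A contradiction arises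
  from counting spokes modulo 2 in two ways. Cyclic orientation at \<open>k\<close> makes the
  directions of consecutive spokes opposite, so that their number, including the spoke to
  \<open>l\<close>, is even. Positivity makes the signed inner products with \<open>g k\<close>
  alternate along the path in the same way, but comparing the first and the last spoke through the two
  triangles that they span with \<open>k\<close> and \<open>l\<close> after contraction of a piece of
  the path shows that this number is odd. The conditions \<open>i0 < n\<close> and \<open>0 <
  i1\<close> guarantee that those pieces meet only one of the two neighbours of
  \<open>l\<close>.\<close>

lemma wheel_impossible:
  assumes g: "gram_companion B g" and skew: "skew_symmetric B" and p: "induced_path B l x y n p"
    and xl: "B $ x $ l \<noteq> 0" and yl: "B $ y $ l \<noteq> 0" and kl: "B $ k $ l \<noteq> 0"
    and nk: "\<And>t. t \<le> n \<Longrightarrow> p t \<noteq> k"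
    and orient: "\<And>u v. u \<noteq> v \<Longrightarrow> B $ u $ k \<noteq> 0 \<Longrightarrow> B $ v $ k \<noteq> 0 \<Longrightarrow> linked B k u v \<Longrightarrow>
      B $ u $ k = - B $ v $ k"
    and i0: "i0 < n" "B $ p i0 $ k \<noteq> 0" "\<And>t. t < i0 \<Longrightarrow> B $ p t $ k = 0"
    and i1: "0 < i1" "i1 \<le> n" "B $ p i1 $ k \<noteq> 0" "\<And>t. i1 < t \<Longrightarrow> t \<le> n \<Longrightarrow> B $ p t $ k = 0"
  shows False
proof -
  note pD = induced_pathD[OF p]
  have lk: "k \<noteq> l" using kl skew_diag[OF skew] by auto
  obtain \<epsilon> where \<epsilon>: "chain_signs \<epsilon> (\<lambda>t. g (p t)) n"
    using induced_path_signs[OF g p] by blast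
  note abs = chain_signsD(1)[OF \<epsilon>] and norm = chain_signsD(3)[OF \<epsilon>]
  define e where "e t = \<epsilon> t * (g (p t) \<bullet> g k)" for t
  define f where "f t = \<epsilon> t * (g (p t) \<bullet> g l)" for t
  define C where "C i j = chain_sum \<epsilon> (\<lambda>t. g (p t)) i j" for i j
  have C_k: "C i j \<bullet> g k = (\<Sum>t\<in>{i..j}. e t)" and C_l: "C i j \<bullet> g l = (\<Sum>t\<in>{i..j}. f t)" for i j
    by (simp_all add: C_def e_def f_def chain_sum_inner)
  have C_norm: "C i j \<bullet> C i j = 2" if "i \<le> j" "j \<le> n" for i j
    using norm that by (simp add: C_def)
  have C_lt: "\<bar>C i j \<bullet> g k\<bar> < 2" "\<bar>C i j \<bullet> g l\<bar> < 2" if "i \<le> j" "j \<le> n" for i j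
    unfolding C_def using path_chain_inner_lt_2[OF g nk that(2) norm[OF that]]
      path_chain_inner_lt_2[OF g pD(7) that(2) norm[OF that]] by simp_all
  have e0: "e t = 0" if "t \<le> n" "B $ p t $ k = 0" for t
    using gram_companion_inner_eq_0[OF g nk] that by (simp add: e_def)
  have e1: "\<bar>e t\<bar> = 1" if "t \<le> n" "B $ p t $ k \<noteq> 0" for t
    using gram_companion_inner_abs_1[OF g nk] that abs by (simp add: e_def abs_mult)
  have f0: "f t = 0" if "0 < t" "t < n" for t
    using gram_companion_inner_eq_0[OF g pD(7) pD(8)] that by (simp add: f_def)
  have f1: "\<bar>f 0\<bar> = 1" "\<bar>f n\<bar> = 1"
    using gram_companion_inner_abs_1[OF g pD(7)[of 0]] gram_companion_inner_abs_1[OF g pD(7)[of n]]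
      xl yl pD(1,2) abs by (simp_all add: f_def abs_mult)
  have i01: "i0 \<le> i1" using i0 i1 by (meson not_le)
  \<comment> \<open>between consecutive spokes both the direction and the signed inner product with \<open>g k\<close> change sign\<close>
  have alternate: "i \<le> n \<Longrightarrow> i0 \<le> i \<Longrightarrow> B $ p i $ k \<noteq> 0 \<Longrightarrow>
      real_of_int (B $ p i $ k) * e i = real_of_int (B $ p i0 $ k) * e i0" for i
  proof (induction i rule: less_induct)
    case (less i)
    show ?case
    proof (cases "i = i0")
      case False
      define T where "T = {t. i0 \<le> t \<and> t < i \<and> B $ p t $ k \<noteq> 0}"
      have "i0 \<in> T" using False less.prems i0 by (simp add: T_def)
      then have T: "finite T" "T \<noteq> {}" by (auto simp: T_def)
      define j where "j = Max T"
      have "j \<in> T" unfolding j_def by (rule Max_in[OF T])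
      then have j: "i0 \<le> j" "j < i" "B $ p j $ k \<noteq> 0" by (auto simp: T_def)
      have gap: "B $ p t $ k = 0" if "j < t" "t < i" for t
      proof (rule ccontr)
        assume "B $ p t $ k \<noteq> 0"
        then have "t \<in> T" using that j by (simp add: T_def)
        then have "t \<le> j" unfolding j_def using T by simp
        then show False using that by simp
      qed
      have "linked B k (p j) (p i)"
        by (rule linked_path) (use j less.prems pD(4) gap nk in auto)
      then have B: "B $ p j $ k = - B $ p i $ k"
        using orient pD(6)[of j i] j less.prems by simp
      have "C j i \<bullet> g k = e j + e i"
        unfolding C_k by (rule sum_only_ends) (use j gap e0 less.prems in auto)
      then have "\<bar>e j + e i\<bar> < 2" using C_lt(1)[of j i] j less.prems by simp
      then have "e j = - e i" using e1[of j] e1[of i] j less.prems by linarith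
      moreover have "real_of_int (B $ p j $ k) * e j = real_of_int (B $ p i0 $ k) * e i0"
        using less.IH[of j] j less.prems by simp
      ultimately show ?thesis using B by simp
    qed simp
  qed
  \<comment> \<open>the initial piece of the path, prolonged by \<open>l\<close>, links \<open>l\<close> to the first spoke; the next step treats the last spoke in the same way\<close>
  have "linked B k (case_nat l p 0) (case_nat l p (Suc i0))"
  proof (rule linked_path)
    fix t assume "t < Suc i0"
    then show "B $ case_nat l p t $ case_nat l p (Suc t) \<noteq> 0"
      using pD(4) i0 xl skew_zero[OF skew, of l x] pD(1) by (cases t) simp_all
  next
    fix t assume "0 < t" "t < Suc i0"
    then show "case_nat l p t \<noteq> k \<and> B $ case_nat l p t $ k = 0"
      using nk i0 by (cases t) simp_all
  qed simp
  then have first: "B $ p i0 $ k = - B $ l $ k"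
    using orient[of l "p i0"] i0 kl skew_zero[OF skew, of k l] pD(7)[of i0] by simp
  have "linked B k ((p(Suc n := l)) i1) ((p(Suc n := l)) (Suc n))"
  proof (rule linked_path)
    fix t assume "i1 \<le> t" "t < Suc n"
    then show "B $ (p(Suc n := l)) t $ (p(Suc n := l)) (Suc t) \<noteq> 0"
      using pD(4) yl pD(2) by (cases "t = n") simp_all
  next
    fix t assume "i1 < t" "t < Suc n"
    then show "(p(Suc n := l)) t \<noteq> k \<and> B $ (p(Suc n := l)) t $ k = 0" using nk i1 by simp
  qed (use i1 in simp)
  then have last: "B $ p i1 $ k = - B $ l $ k"
    using orient[of "p i1" l] i1 kl skew_zero[OF skew, of k l] pD(7)[of i1] by simp
  have eq: "e i0 = e i1"
    using alternate[OF i1(2) i01 i1(3)] first last i0 by simp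
  have e_abs: "\<bar>e i0\<bar> = 1" using e1 i0 by simp
  have kl_abs: "\<bar>g k \<bullet> g l\<bar> = 1" by (rule gram_companion_inner_abs_1[OF g lk kl])
  have tri: "(C i j \<bullet> g k) * (C i j \<bullet> g l) * (g k \<bullet> g l) = 1"
    if "i \<le> j" "j \<le> n" "\<bar>C i j \<bullet> g k\<bar> = 1" "\<bar>C i j \<bullet> g l\<bar> = 1" for i j
  proof (rule triangle_product)
    show "C i j \<in> span (g ` (- {l}))"
      unfolding C_def by (rule induced_path_chain_in_span[OF pD(7) that(2)])
    show "g k \<in> span (g ` (- {l}))" by (rule span_base) (use lk in simp)
    show "g l \<notin> span (g ` (- {l}))" by (rule gram_companion_notin_span[OF g]) simp
  qed (use that C_norm gram_companion_norm[OF g] kl_abs in simp_all)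
  have "C 0 i0 \<bullet> g k = e i0" unfolding C_k by (rule sum_only_one) (use i0 e0 in auto)
  moreover have "C 0 i0 \<bullet> g l = f 0" unfolding C_l by (rule sum_only_one) (use i0 f0 in auto)
  ultimately have t0: "e i0 * f 0 * (g k \<bullet> g l) = 1" using tri[of 0 i0] i0 f1 e_abs by simp
  have "C i1 n \<bullet> g k = e i1" unfolding C_k by (rule sum_only_one) (use i1 e0 in auto)
  moreover have "C i1 n \<bullet> g l = f n" unfolding C_l by (rule sum_only_one) (use i1 f0 in auto)
  ultimately have t1: "e i1 * f n * (g k \<bullet> g l) = 1" using tri[of i1 n] i1 f1 e_abs eq by simp
  have "e i0 = 1 \<or> e i0 = - 1" "g k \<bullet> g l = 1 \<or> g k \<bullet> g l = - 1" using e_abs kl_abs by linarith+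
  then have "f 0 = f n" using t0 t1 by (elim disjE) (simp_all flip: eq)
  moreover have "C 0 n \<bullet> g l = f 0 + f n" unfolding C_l by (rule sum_only_ends) (use pD(3) f0 in auto)
  ultimately show False using C_lt(2)[of 0 n] f1 by linarith
qed

section \<open>Invariance of cyclic orientation under mutation\<close>

text \<open>Mutation at \<open>k\<close> reverses all arrows at \<open>k\<close> and otherwise only
  changes entries between a source and a target of a path of length 2 through \<open>k\<close>. If
  \<open>x\<close> and \<open>y\<close> lie on the same side of \<open>k\<close>, no step of the walk
  is of this kind, so the walk already existed before.\<close>

lemma mutation_oriented_at_k:
  assumes le1: "\<And>u v. \<bar>B $ u $ v\<bar> \<le> 1" and skew: "skew_symmetric B" and cyc: "cyclically_oriented B"
    and xy: "x \<noteq> y" "mutation k B $ x $ k \<noteq> 0" "mutation k B $ y $ k \<noteq> 0" "linked (mutation k B) k x y"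
  shows "mutation k B $ x $ k = - mutation k B $ y $ k"
proof (rule ccontr)
  assume ne: "mutation k B $ x $ k \<noteq> - mutation k B $ y $ k"
  have nz: "B $ x $ k \<noteq> 0" "B $ y $ k \<noteq> 0" using xy by (simp_all add: mutation_entry_k)
  have "B $ x $ k \<noteq> - B $ y $ k" using ne by (simp add: mutation_entry_k)
  have eq: "B $ x $ k \<noteq> B $ k $ y"
    using \<open>B $ x $ k \<noteq> - B $ y $ k\<close> skew_entry[OF skew, of k y] by simp
  have "(\<lambda>u v. mutation k B $ u $ v \<noteq> 0 \<and> (u = x \<or> u \<noteq> k \<and> mutation k B $ u $ k = 0) \<and>
      (v = y \<or> v \<noteq> k \<and> mutation k B $ v $ k = 0)) \<le>
    (\<lambda>u v. B $ u $ v \<noteq> 0 \<and> (u = x \<or> u \<noteq> k \<and> B $ u $ k = 0) \<and> (v = y \<or> v \<noteq> k \<and> B $ v $ k = 0))"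
  proof (intro predicate2I, elim conjE, intro conjI)
    fix u v
    assume uv: "mutation k B $ u $ v \<noteq> 0" "u = x \<or> u \<noteq> k \<and> mutation k B $ u $ k = 0"
      "v = y \<or> v \<noteq> k \<and> mutation k B $ v $ k = 0"
    then show u: "u = x \<or> u \<noteq> k \<and> B $ u $ k = 0" and v: "v = y \<or> v \<noteq> k \<and> B $ v $ k = 0"
      by (auto simp: mutation_entry_k)
    have "u \<noteq> k" "v \<noteq> k" using u v nz skew_diag[OF skew, of k] by auto
    moreover have "B $ u $ k = B $ k $ v \<Longrightarrow> B $ u $ k = 0"
      using u v eq skew_zero[OF skew, of k v] by auto
    ultimately have "mutation k B $ u $ v = B $ u $ v"
      using mutation_entry[OF _ _ le1 le1] by auto
    then show "B $ u $ v \<noteq> 0" using uv by simp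
  qed
  then have "linked B k x y" using xy(4) unfolding linked_def by (blast dest: rtranclp_mono)
  then have "B $ x $ k = - B $ y $ k" by (rule cyclically_orientedD[OF cyc xy(1) nz])
  then show False using \<open>B $ x $ k \<noteq> - B $ y $ k\<close> by simp
qed

text \<open>Nothing changes at \<open>l\<close>. An edge of the walk created by the mutation is
  replaced by the detour through \<open>k\<close>, which is allowed because \<open>k\<close> is not
  adjacent to \<open>l\<close>.\<close>

lemma mutation_oriented_away_from_k:
  assumes le1: "\<And>u v. \<bar>B $ u $ v\<bar> \<le> 1" and skew: "skew_symmetric B" and cyc: "cyclically_oriented B"
    and l: "l \<noteq> k" "B $ k $ l = 0"
    and xy: "x \<noteq> y" "mutation k B $ x $ l \<noteq> 0" "mutation k B $ y $ l \<noteq> 0" "linked (mutation k B) l x y"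
  shows "mutation k B $ x $ l = - mutation k B $ y $ l"
proof -
  have same: "mutation k B $ z $ l = B $ z $ l" for z
    using mutation_entry[OF _ l(1) le1 le1, of z] l(2) by (cases "z = k") (auto simp: mutation_entry_k)
  let ?R' = "\<lambda>u v. mutation k B $ u $ v \<noteq> 0 \<and> (u = x \<or> u \<noteq> l \<and> mutation k B $ u $ l = 0) \<and>
      (v = y \<or> v \<noteq> l \<and> mutation k B $ v $ l = 0)"
  let ?R = "\<lambda>u v. B $ u $ v \<noteq> 0 \<and> (u = x \<or> u \<noteq> l \<and> B $ u $ l = 0) \<and> (v = y \<or> v \<noteq> l \<and> B $ v $ l = 0)"
  have "?R' \<le> ?R\<^sup>*\<^sup>*"
  proof (rule predicate2I)
    fix u v assume uv: "?R' u v"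
    show "?R\<^sup>*\<^sup>* u v"
    proof (cases "B $ u $ v = 0")
      case False
      then have "?R u v" using uv same by simp
      then show ?thesis by (rule r_into_rtranclp)
    next
      case True
      then have ne: "u \<noteq> k" "v \<noteq> k" using uv by (auto simp: mutation_entry_k)
      have "B $ u $ k \<noteq> 0" "B $ k $ v \<noteq> 0"
        using uv mutation_entry[OF ne le1 le1] True by (auto split: if_splits)
      then have "?R u k" and "?R k v" using uv same l by simp_all
      then show ?thesis
        by (rule rtranclp_trans[OF r_into_rtranclp[of ?R u k] r_into_rtranclp[of ?R k v]])
    qed
  qed
  from rtranclp_mono[OF this] have "?R'\<^sup>*\<^sup>* \<le> ?R\<^sup>*\<^sup>*" unfolding rtranclp_idemp .
  then have "linked B l x y" using xy(4) unfolding linked_def by blast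
  then show ?thesis using cyclically_orientedD[OF cyc xy(1)] xy(2,3) by (simp add: same)
qed

text \<open>What remains is the case of a vertex \<open>l\<close> adjacent to \<open>k\<close>. In
  terms of chordless cycles of the mutated quiver through \<open>l\<close>: a cycle through
  \<open>k\<close> longer than a triangle comes from one that bypasses \<open>k\<close> by an edge
  between \<open>l\<close> and the other neighbour of \<open>k\<close>, since otherwise it would have
  existed before with a wrong orientation at \<open>k\<close> (\<open>from_k\<close>). For a cycle
  avoiding \<open>k\<close>, the set \<open>J\<close> records the positions on the path that are
  adjacent to \<open>k\<close>. If \<open>J\<close> is empty, the cycle is not affected. If
  \<open>J\<close> consists of one end of the path, the edge from this end to \<open>l\<close> was
  created by the mutation and the cycle is the contraction of a longer one through \<open>k\<close>.
  In all other cases \<open>k\<close> would be the hub of an impossible wheel.\<close>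

theorem cyclically_oriented_mutation:
  fixes g :: "'v::finite \<Rightarrow> 'a::euclidean_space"
  assumes g: "gram_companion B g" and skew: "skew_symmetric B" and cyc: "cyclically_oriented B"
  shows "cyclically_oriented (mutation k B)"
proof -
  define B' where "B' = mutation k B"
  have skew': "skew_symmetric B'" unfolding B'_def by (rule skew_symmetric_mutation[OF skew])
  have le1: "\<bar>B $ u $ v\<bar> \<le> 1" for u v
    using gram_companion_entry_le_1[OF g, of u v] skew_diag[OF skew] by (cases "u = v") simp_all
  have entry: "B' $ u $ v = B $ u $ v + (if B $ u $ k = B $ k $ v then B $ u $ k else 0)"
    if "u \<noteq> k" "v \<noteq> k" for u v
    unfolding B'_def by (rule mutation_entry[OF that le1 le1])
  have entry_k: "B' $ k $ u = - B $ k $ u" "B' $ u $ k = - B $ u $ k" for u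
    by (simp_all add: B'_def mutation_entry_k)
  have at_k: "B' $ x $ k = - B' $ y $ k"
    if "x \<noteq> y" "B' $ x $ k \<noteq> 0" "B' $ y $ k \<noteq> 0" "linked B' k x y" for x y
    using mutation_oriented_at_k[OF le1 skew cyc that[unfolded B'_def]] by (simp add: B'_def)
  have near_k: "B' $ x $ l = - B' $ y $ l"
    if lk: "l \<noteq> k" and kl: "B $ k $ l \<noteq> 0" and xy: "x \<noteq> y" and xl: "B' $ x $ l \<noteq> 0"
      and yl: "B' $ y $ l \<noteq> 0" and link: "linked B' l x y" for l x y
  proof -
    define s where "s = B $ k $ l"
    have s: "s \<noteq> 0" using kl by (simp add: s_def)
    have lk_s: "B $ l $ k = - s" unfolding s_def by (rule skew_entry[OF skew])
    have kl': "B' $ k $ l = - s" by (simp add: entry_k s_def)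
    \<comment> \<open>the vertex \<open>z\<close> is joined to \<open>k\<close> by an arrow on the other side than \<open>l\<close> (\<open>T1\<close>), on the same side (\<open>T2\<close>), or not at all (\<open>T3\<close>)\<close>
    have T1: "B $ z $ l = 0 \<and> B' $ z $ l = s \<or> B $ z $ l = - s \<and> B' $ z $ l = 0" if "z \<noteq> k" "B $ z $ k = s" for z
    proof -
      have "B $ z $ l = 0 \<or> B $ z $ l = - s"
        using cyclically_oriented_triangle[OF cyc that(1), of l] kl that(2) s by (auto simp: s_def)
      then show ?thesis using entry[OF that(1) lk] that(2) s by (auto simp: s_def)
    qed
    have T2: "B $ z $ l = 0 \<and> B' $ z $ l = 0" if "z \<noteq> k" "B $ z $ k = - s" for z
    proof -
      have "B $ z $ l = 0"
      proof (rule ccontr)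
        assume nz: "B $ z $ l \<noteq> 0"
        then have "z \<noteq> l" using skew_diag[OF skew] by auto
        then show False
          using cyclically_oriented_triangle[OF cyc, of z l k] nz that(2) s lk_s by simp
      qed
      then show ?thesis using entry[OF that(1) lk] that(2) s by (simp add: s_def)
    qed
    have T3: "B' $ z $ l = B $ z $ l" if "z \<noteq> k" "B $ z $ k = 0" for z
      using entry[OF that(1) lk] that(2) by simp
    have val: "B $ z $ k = s \<or> B $ z $ k = - s" if "B $ z $ k \<noteq> 0" for z
      using le1[of z k] le1[of k l] that s unfolding s_def by linarith
    have nbr: "B $ z $ k = s" "B $ z $ l = 0" "B' $ z $ l = s"
      if "z \<noteq> k" "B $ z $ k \<noteq> 0" "B' $ z $ l \<noteq> 0" for z
      using T1[OF that(1)] T2[OF that(1)] val[OF that(2)] that(3) by auto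
    have edge: "B' $ u $ v = B $ u $ v" if "u \<noteq> k" "v \<noteq> k" "B $ u $ k = 0 \<or> B $ v $ k = 0" for u v
      using entry[OF that(1,2)] that(3) skew_zero[OF skew, of k v] by auto
    have from_k: "B' $ z $ l = s" if zk: "z \<noteq> k" and zl: "B' $ z $ l \<noteq> 0" and link: "linked B' l k z" for z
    proof (cases "B $ z $ k = 0")
      case False
      then show ?thesis using nbr zk zl by simp
    next
      case True
      have "B' $ k $ l \<noteq> 0" using kl' s by simp
      then obtain n p where p: "induced_path B' l k z n p"
        using linked_induced_path[OF skew' link zk[symmetric] _ zl] by blast
      note pD = induced_pathD[OF p]
      have nk: "p t \<noteq> k" if "0 < t" "t \<le> n" for t using pD(6)[of 0 t] pD(1) that by auto
      have far: "B $ p t $ k = 0" if "1 < t" "t \<le> n" for t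
        using pD(5)[of 0 t] pD(1) that entry_k skew_zero[OF skew, of k "p t"] by simp
      have p1: "B $ p 1 $ k \<noteq> 0"
        using pD(4)[of 0] pD(1,3) entry_k skew_zero[OF skew, of k "p 1"] by simp
      then have n: "1 < n" using pD(2,3) True by (metis One_nat_def Suc_lessI)
      have edges: "B $ p t $ p (Suc t) \<noteq> 0" if "1 \<le> t" "t < n" for t
        using pD(4)[of t] edge[OF nk nk far[THEN disjI2], of t "Suc t"] that by simp
      have off: "B $ p t $ l = 0" if "1 < t" "t < n" for t
        using pD(8)[of t] T3[OF nk far, of t] that by simp
      have B'p1: "B' $ p 1 $ l = 0" using pD(8)[of 1] n by simp
      have zz: "B $ z $ l = B' $ z $ l" using T3[OF zk True] by simp
      consider "B $ p 1 $ k = s" | "B $ p 1 $ k = - s" using val[OF p1] by blast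
      then show ?thesis
      proof cases
        case 1
        then have p1l: "B $ p 1 $ l = - s" using T1[OF nk, of 1] n B'p1 s by auto
        have "linked B l (p 1) (p n)"
          by (rule linked_path) (use n edges off pD(7) in auto)
        then have "B $ p 1 $ l = - B $ z $ l"
          using cyclically_orientedD[OF cyc, of "p 1" z l] pD(2) pD(6)[of 1 n] n p1l s zz zl by simp
        then show ?thesis using p1l zz by simp
      next
        case 2
        have "linked B k ((p(Suc n := l)) 1) ((p(Suc n := l)) (Suc n))"
        proof (rule linked_path)
          fix t assume "1 \<le> t" "t < Suc n"
          then show "B $ (p(Suc n := l)) t $ (p(Suc n := l)) (Suc t) \<noteq> 0"
            using edges[of t] zz zl pD(2) by (cases "t = n") simp_all
        next
          fix t assume "1 < t" "t < Suc n"
          then show "(p(Suc n := l)) t \<noteq> k \<and> B $ (p(Suc n := l)) t $ k = 0"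
            using nk[of t] far[of t] by simp
        qed simp
        then have "B $ p 1 $ k = - B $ l $ k"
          using cyclically_orientedD[OF cyc, of "p 1" l k] pD(7)[of 1] n p1 lk_s s by simp
        then show ?thesis using 2 lk_s s by simp
      qed
    qed
    show ?thesis
    proof (cases "x = k \<or> y = k")
      case True
      then show ?thesis
        using from_k[of y] from_k[of x] linked_sym[OF skew' link] link xy xl yl kl' by auto
    next
      case False
      then have xk: "x \<noteq> k" and yk: "y \<noteq> k" by auto
      obtain n p where p: "induced_path B' l x y n p"
        using linked_induced_path[OF skew' link xy xl yl] by blast
      note pD = induced_pathD[OF p]
      have nk: "p t \<noteq> k" if "t \<le> n" for t
        using pD(8)[of t] pD(1,2) xk yk that kl' s by (cases "t = 0"; cases "t = n") auto
      define J where "J = {t. t \<le> n \<and> B $ p t $ k \<noteq> 0}"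
      have finJ: "finite J" by (simp add: J_def)
      have edges: "B $ p t $ p (Suc t) \<noteq> 0" if "t < n" "t \<notin> J \<or> Suc t \<notin> J" for t
        using pD(4)[of t] edge[OF nk nk, of t "Suc t"] that by (auto simp: J_def)
      have off: "B $ p t $ l = 0" if "0 < t" "t < n" "t \<notin> J" for t
        using pD(8)[of t] T3[OF nk, of t] that by (auto simp: J_def)
      have x_same: "B' $ x $ l = B $ x $ l" if "0 \<notin> J" using T3[OF xk] that pD(1) by (simp add: J_def)
      have y_same: "B' $ y $ l = B $ y $ l" if "n \<notin> J" using T3[OF yk] that pD(2) by (simp add: J_def)
      consider "J = {}" | "J = {0}" | "J = {n}" | "J \<noteq> {}" "J \<noteq> {0}" "J \<noteq> {n}" by blast
      then show ?thesis
      proof cases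
        case 1
        have "linked B l (p 0) (p n)"
          by (rule linked_path) (use 1 edges off pD(7) in auto)
        then show ?thesis
          using cyclically_orientedD[OF cyc xy, of l] pD(1,2) xl yl x_same y_same 1 by simp
      next
        case 2
        have "0 \<in> J" using 2 by simp
        then have x: "B $ x $ k \<noteq> 0" "B $ x $ l = 0" "B' $ x $ l = s"
          using nbr[OF xk _ xl] pD(1) by (simp_all add: J_def)
        have "linked B l (case_nat k p 0) (case_nat k p (Suc n))"
        proof (rule linked_path)
          fix t assume "t < Suc n"
          then show "B $ case_nat k p t $ case_nat k p (Suc t) \<noteq> 0"
            using edges[of "t - 1"] 2 x(1) skew_zero[OF skew, of k x] pD(1) by (cases t) simp_all
        next
          fix t assume t: "0 < t" "t < Suc n"
          then show "case_nat k p t \<noteq> l \<and> B $ case_nat k p t $ l = 0"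
            using off[of "t - 1"] pD(7)[of "t - 1"] 2 x(2) pD(1) by (cases t; cases "t = 1") simp_all
        qed simp
        then have "B $ k $ l = - B $ y $ l"
          using cyclically_orientedD[OF cyc yk[symmetric] kl] yl y_same 2 pD(2,3) by simp
        then show ?thesis using y_same 2 pD(3) x(3) by (simp add: s_def)
      next
        case 3
        have "n \<in> J" using 3 by simp
        then have y: "B $ y $ k \<noteq> 0" "B $ y $ l = 0" "B' $ y $ l = s"
          using nbr[OF yk _ yl] pD(2) by (simp_all add: J_def)
        have "linked B l ((p(Suc n := k)) 0) ((p(Suc n := k)) (Suc n))"
        proof (rule linked_path)
          fix t assume "t < Suc n"
          then show "B $ (p(Suc n := k)) t $ (p(Suc n := k)) (Suc t) \<noteq> 0"
            using edges[of t] 3 y(1) pD(2) by (cases "t = n") simp_all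
        next
          fix t assume t: "0 < t" "t < Suc n"
          then show "(p(Suc n := k)) t \<noteq> l \<and> B $ (p(Suc n := k)) t $ l = 0"
            using off[of t] pD(7)[of t] 3 y(2) pD(2) by (cases "t = n") simp_all
        qed simp
        then have "B $ x $ l = - B $ k $ l"
          using cyclically_orientedD[OF cyc xk _ kl] xl x_same 3 pD(1,3) by simp
        then show ?thesis using x_same 3 pD(3) y(3) by (simp add: s_def)
      next
        case 4
        have min: "Min J \<in> J" and max: "Max J \<in> J" using finJ 4 by simp_all
        have below: "B $ p t $ k = 0" if "t < Min J" for t
        proof (rule ccontr)
          assume "B $ p t $ k \<noteq> 0"
          then have "t \<in> J" using that min by (simp add: J_def)
          then show False using Min_le[OF finJ] that by fastforce
        qed
        have above: "B $ p t $ k = 0" if "Max J < t" "t \<le> n" for t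
        proof (rule ccontr)
          assume "B $ p t $ k \<noteq> 0"
          then have "t \<in> J" using that by (simp add: J_def)
          then show False using Max_ge[OF finJ] that by fastforce
        qed
        have Min_lt: "Min J < n"
        proof (rule ccontr)
          assume ge: "\<not> Min J < n"
          have "t = n" if "t \<in> J" for t
          proof -
            have "Min J \<le> t" "t \<le> n" using Min_le[OF finJ that] that by (simp_all add: J_def)
            then show ?thesis using ge by linarith
          qed
          then show False using 4 by blast
        qed
        have Max_pos: "0 < Max J"
        proof (rule ccontr)
          assume "\<not> 0 < Max J"
          then have "t = 0" if "t \<in> J" for t using Max_ge[OF finJ that] by simp
          then show False using 4 by blast
        qed
        have g': "gram_companion B' (inward_mutation B k g)"
          unfolding B'_def by (rule gram_companion_inward_mutation[OF g skew cyc])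
        have "B' $ k $ l \<noteq> 0" using kl' s by simp
        from wheel_impossible[OF g' skew' p xl yl this nk at_k Min_lt _ _ Max_pos]
        have False
        proof
          show "B' $ p (Min J) $ k \<noteq> 0" "Max J \<le> n" "B' $ p (Max J) $ k \<noteq> 0"
            using min max by (simp_all add: J_def entry_k)
          show "B' $ p t $ k = 0" if "t < Min J" for t using below[OF that] by (simp add: entry_k)
          show "B' $ p t $ k = 0" if "Max J < t" "t \<le> n" for t using above[OF that] by (simp add: entry_k)
        qed
        then show ?thesis by simp
      qed
    qed
  qed
  have "B' $ x $ l = - B' $ y $ l"
    if "x \<noteq> y" "B' $ x $ l \<noteq> 0" "B' $ y $ l \<noteq> 0" "linked B' l x y" for l x y
  proof -
    consider "l = k" | "l \<noteq> k" "B $ k $ l = 0" | "l \<noteq> k" "B $ k $ l \<noteq> 0" by blast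
    then show ?thesis
    proof cases
      case 1 then show ?thesis using at_k that by simp
    next
      case 2
      then show ?thesis
        using mutation_oriented_away_from_k[OF le1 skew cyc 2 that[unfolded B'_def]] by (simp add: B'_def)
    next
      case 3 then show ?thesis using near_k that by blast
    qed
  qed
  then show ?thesis unfolding cyclically_oriented_def B'_def by blast
qed

text \<open>The simple roots form a Gram companion of \<open>B\<^sub>0\<close> with nonpositive
  inner products. Both the companion and the orientation property are carried along the mutations from
  \<open>B\<^sub>0\<close> back to \<open>B\<close>.\<close>

lemma cyclically_oriented_of_exchange_matrix:
  fixes B :: "int ^ 'v ^ 'v::finite" and \<Phi> S :: "'a::euclidean_space set"
  assumes root: "root_system_of_type \<Delta> \<Phi> S" and ex: "exchange_matrix_of_type \<Delta> B"
  shows "cyclically_oriented B"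
proof -
  have skew: "skew_symmetric B" using ex by (simp add: exchange_matrix_of_type_def)
  obtain B0 where B0: "mutation_equivalent B B0"
    "is_cartan_matrix_of_type \<Delta> UNIV (\<lambda>x y. cartan_counterpart B0 $ x $ y)"
    using ex by (auto simp: exchange_matrix_of_type_def)
  define I where "I = {1..dynkin_rank \<Delta>}"
  obtain \<sigma> where \<sigma>: "bij_betw \<sigma> I UNIV"
    "\<forall>i\<in>I. \<forall>j\<in>I. cartan_counterpart B0 $ \<sigma> i $ \<sigma> j = cartan_entry \<Delta> i j"
    using B0(2) by (auto simp: is_cartan_matrix_of_type_def I_def)
  obtain \<tau> where \<tau>: "bij_betw \<tau> I S" "\<forall>i\<in>I. \<forall>j\<in>I. \<tau> i \<bullet> \<tau> j = real_of_int (cartan_entry \<Delta> i j)"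
    using root by (auto simp: root_system_of_type_def is_cartan_matrix_of_type_def I_def)
  have indep: "independent S" using root by (simp add: root_system_of_type_def simple_system_def)
  define g where "g = \<tau> \<circ> inv_into I \<sigma>"
  have g_bij: "bij_betw g UNIV S"
    unfolding g_def by (rule bij_betw_trans[OF bij_betw_inv_into[OF \<sigma>(1)] \<tau>(1)])
  have g_inner: "g x \<bullet> g y = real_of_int (cartan_counterpart B0 $ x $ y)" for x y
  proof -
    have "inv_into I \<sigma> z \<in> I" "\<sigma> (inv_into I \<sigma> z) = z" for z
      using \<sigma>(1) by (simp_all add: bij_betw_def inv_into_into f_inv_into_f)
    then show ?thesis using \<sigma>(2) \<tau>(2) unfolding g_def comp_def by metis
  qed
  have coeffs: "c x = 0" if 0: "(\<Sum>x\<in>UNIV. c x *\<^sub>R g x) = 0" for c x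
  proof -
    have inv: "inv g (g z) = z" for z using g_bij by (simp add: bij_betw_def)
    have "(\<Sum>b\<in>g ` UNIV. c (inv g b) *\<^sub>R b) = (\<Sum>x\<in>UNIV. c x *\<^sub>R g x)"
      using g_bij by (subst sum.reindex) (simp_all add: bij_betw_def inv)
    then have "(\<Sum>b\<in>range g. c (inv g b) *\<^sub>R b) = 0" using 0 by simp
    moreover have "independent (range g)" using indep g_bij by (simp add: bij_betw_def)
    ultimately have "c (inv g (g x)) = 0"
      using independentD[of "range g" "range g" "\<lambda>b. c (inv g b)" "g x"] by simp
    then show ?thesis by (simp add: inv)
  qed
  have g0: "gram_companion B0 g"
    unfolding gram_companion_def using coeffs by (simp add: g_inner cartan_counterpart_def)
  have nonpos: "x \<noteq> y \<Longrightarrow> g x \<bullet> g y \<le> 0" for x y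
    by (simp add: g_inner cartan_counterpart_def)
  have "skew_symmetric B \<longrightarrow> cyclically_oriented B \<and> (\<exists>g :: 'v \<Rightarrow> 'a. gram_companion B g)"
    using B0(1) unfolding mutation_equivalent_def
  proof (induction rule: converse_rtranclp_induct)
    case base
    then show ?case using cyclically_oriented_of_nonpositive_companion[OF g0 _ nonpos] g0 by blast
  next
    case (step B B')
    then obtain k where k: "B' = mutation k B" by blast
    show ?case
    proof
      assume "skew_symmetric B"
      then have skew': "skew_symmetric B'" unfolding k by (rule skew_symmetric_mutation)
      then obtain g :: "'v \<Rightarrow> 'a" where g: "gram_companion B' g" and cyc: "cyclically_oriented B'"
        using step.IH by blast
      have "mutation k B' = B" unfolding k by (rule mutation_involution)
      then show "cyclically_oriented B \<and> (\<exists>g :: 'v \<Rightarrow> 'a. gram_companion B g)"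
        using cyclically_oriented_mutation[OF g skew' cyc, of k]
          gram_companion_inward_mutation[OF g skew' cyc, of k] by auto
    qed
  qed
  with skew show ?thesis by blast
qed

section \<open>Uniqueness of Gram companions up to signs\<close>

lemma gram_companion_inner_Ints:
  assumes "gram_companion B g" shows "g x \<bullet> g y \<in> \<int>"
proof (cases "x = y")
  case True
  then show ?thesis using gram_companion_norm[OF assms] by simp
next
  case False
  then have "g x \<bullet> g y = real_of_int (B $ x $ y) \<or> g x \<bullet> g y = - real_of_int (B $ x $ y)"
    using gram_companion_abs[OF assms False] by linarith
  then show ?thesis by (metis Ints_minus Ints_of_int)
qed

lemma gram_companion_change_signs:
  assumes g: "gram_companion B g" and \<epsilon>: "\<And>x. \<epsilon> x = 1 \<or> \<epsilon> x = (- 1 :: int)"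
  shows "gram_companion B (\<lambda>x. real_of_int (\<epsilon> x) *\<^sub>R g x)"
proof -
  have abs: "\<bar>real_of_int (\<epsilon> x)\<bar> = 1" for x using \<epsilon>[of x] by auto
  have sq: "real_of_int (\<epsilon> x) * real_of_int (\<epsilon> x) = 1" for x using \<epsilon>[of x] by auto
  have "c x = 0" if "(\<Sum>x\<in>UNIV. c x *\<^sub>R (real_of_int (\<epsilon> x) *\<^sub>R g x)) = 0" for c x
  proof -
    have "c x * real_of_int (\<epsilon> x) = 0"
      by (rule gram_companion_coeffs[OF g]) (use that in simp)
    then show ?thesis using \<epsilon>[of x] by auto
  qed
  then show ?thesis
    unfolding gram_companion_def
    using gram_companion_abs[OF g] gram_companion_norm[OF g] by (simp add: abs_mult abs sq flip: mult.assoc)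
qed

text \<open>Vectors \<open>p\<close> and \<open>q\<close> playing the same role in the subspaces
  spanned by \<open>g ` W\<close> and \<open>h ` W\<close>, on which moreover the forms given by
  \<open>g v\<close> and \<open>h v\<close> take the same nonzero value.\<close>

definition twin_roots ::
  "'v set \<Rightarrow> 'v \<Rightarrow> ('v \<Rightarrow> 'a::real_inner) \<Rightarrow> ('v \<Rightarrow> 'b::real_inner) \<Rightarrow> 'a \<Rightarrow> 'b \<Rightarrow> bool" where
  "twin_roots W v g h p q \<longleftrightarrow> p \<in> span (g ` W) \<and> q \<in> span (h ` W) \<and> p \<bullet> p = 2 \<and> q \<bullet> q = 2 \<and>
     (\<forall>x\<in>W. p \<bullet> g x = q \<bullet> h x \<and> p \<bullet> g x \<in> \<int>) \<and> p \<bullet> g v = q \<bullet> h v \<and> 1 \<le> \<bar>p \<bullet> g v\<bar>"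

text \<open>Call \<open>m\<close> bad if \<open>g v\<close> and \<open>h v\<close> have opposite
  nonzero inner products with \<open>g m\<close> and \<open>h m\<close>. If twin roots
  \<open>p\<close>, \<open>q\<close> are not orthogonal to a bad vertex, reflecting them in it gives
  vectors whose inner products with \<open>g v\<close> and \<open>h v\<close> are the sum and the
  difference of two numbers of absolute value at least 1, so one of them is at least 2 in absolute
  value, against positivity. Otherwise one walks towards \<open>m\<close>: a vertex on which \<open>g
  v\<close> and \<open>h v\<close> vanish is absorbed into the twin roots by a reflection or skipped,
  and a vertex on which they agree provides new twin roots.\<close>

lemma no_twin_roots_linked_to_bad:
  fixes g :: "'v::finite \<Rightarrow> 'a::real_inner" and h :: "'v \<Rightarrow> 'b::real_inner"
  assumes g: "gram_companion B g" and h: "gram_companion B h" and v: "v \<notin> W"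
    and same: "\<And>x y. x \<in> W \<Longrightarrow> y \<in> W \<Longrightarrow> h x \<bullet> h y = g x \<bullet> g y"
    and path: "(\<lambda>x y. x \<in> W \<and> y \<in> W \<and> g x \<bullet> g y \<noteq> 0)\<^sup>*\<^sup>* y m"
    and m: "m \<in> W" "g m \<bullet> g v \<noteq> 0" "h m \<bullet> h v = - (g m \<bullet> g v)"
    and pq: "twin_roots W v g h p q" "p \<bullet> g y \<noteq> 0"
  shows False
proof -
  have norm: "(u - (u \<bullet> w) *\<^sub>R w) \<bullet> (u - (u \<bullet> w) *\<^sub>R w) = 2"
    if "u \<bullet> u = 2" "w \<bullet> w = 2" for u w :: "'c::real_inner"
    using that by (simp add: inner_diff_left inner_diff_right inner_commute algebra_simps)
  have bad: False
    if pq: "twin_roots W v g h p q" and y: "y \<in> W" "p \<bullet> g y \<noteq> 0" "g y \<bullet> g v \<noteq> 0" "h y \<bullet> h v = - (g y \<bullet> g v)"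
    for p q y
  proof -
    define t where "t = p \<bullet> g y"
    define a where "a = g y \<bullet> g v"
    define f where "f = p \<bullet> g v"
    have p: "p \<in> span (g ` W)" "p \<bullet> p = 2" and q: "q \<in> span (h ` W)" "q \<bullet> q = 2"
      and tq: "q \<bullet> h y = t" and t: "1 \<le> \<bar>t\<bar>" and fq: "q \<bullet> h v = f" and f: "1 \<le> \<bar>f\<bar>"
      using pq y Ints_nonzero_abs_ge1[of t] by (auto simp: twin_roots_def t_def f_def)
    have a: "1 \<le> \<bar>a\<bar>" using gram_companion_inner_Ints[OF g] y Ints_nonzero_abs_ge1[where 'a = real] by (simp add: a_def)
    have "1 * 1 \<le> \<bar>t\<bar> * \<bar>a\<bar>" by (rule mult_mono) (use t a in auto)
    then have ta: "1 \<le> \<bar>t * a\<bar>" by (simp add: abs_mult)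
    have "\<bar>(p - t *\<^sub>R g y) \<bullet> g v\<bar> < 2"
    proof (rule inner_bound_of_square_length_2)
      show "p - t *\<^sub>R g y \<in> span (g ` W)" using p y by (intro span_diff span_scale) (auto intro: span_base)
      show "(p - t *\<^sub>R g y) \<bullet> (p - t *\<^sub>R g y) = 2"
        using norm[OF p(2) gram_companion_norm[OF g]] by (simp add: t_def)
    qed (use gram_companion_norm[OF g] gram_companion_notin_span[OF g v] in auto)
    moreover have "\<bar>(q - t *\<^sub>R h y) \<bullet> h v\<bar> < 2"
    proof (rule inner_bound_of_square_length_2)
      show "q - t *\<^sub>R h y \<in> span (h ` W)" using q y by (intro span_diff span_scale) (auto intro: span_base)
      show "(q - t *\<^sub>R h y) \<bullet> (q - t *\<^sub>R h y) = 2"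
        using norm[OF q(2) gram_companion_norm[OF h, of y]] by (simp add: tq)
    qed (use gram_companion_norm[OF h] gram_companion_notin_span[OF h v] in auto)
    ultimately have "\<bar>f - t * a\<bar> < 2" "\<bar>f + t * a\<bar> < 2"
      using y by (simp_all add: inner_diff_left f_def a_def fq[unfolded f_def])
    then show False using f ta by linarith
  qed
  have twin_basis: "twin_roots W v g h (g y) (h y)"
    if "y \<in> W" "g y \<bullet> g v \<noteq> 0" "h y \<bullet> h v = g y \<bullet> g v" for y
    using that same gram_companion_norm[OF g] gram_companion_norm[OF h]
      gram_companion_inner_Ints[OF g] Ints_nonzero_abs_ge1[where 'a = real]
    by (auto simp: twin_roots_def intro: span_base)
  have twin_reflect: "twin_roots W v g h (p - (p \<bullet> g y) *\<^sub>R g y) (q - (p \<bullet> g y) *\<^sub>R h y)"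
    if pq: "twin_roots W v g h p q" and y: "y \<in> W" "g y \<bullet> g v = 0" "h y \<bullet> h v = 0" for p q y
  proof -
    have *: "p \<in> span (g ` W)" "q \<in> span (h ` W)" "p \<bullet> p = 2" "q \<bullet> q = 2" "p \<bullet> g v = q \<bullet> h v"
      "1 \<le> \<bar>p \<bullet> g v\<bar>" and W: "\<And>x. x \<in> W \<Longrightarrow> q \<bullet> h x = p \<bullet> g x \<and> p \<bullet> g x \<in> \<int>"
      using pq by (auto simp: twin_roots_def)
    have "p - (p \<bullet> g y) *\<^sub>R g y \<in> span (g ` W)" "q - (p \<bullet> g y) *\<^sub>R h y \<in> span (h ` W)"
      using * y by (auto intro!: span_diff span_scale intro: span_base)
    moreover have "(p - (p \<bullet> g y) *\<^sub>R g y) \<bullet> (p - (p \<bullet> g y) *\<^sub>R g y) = 2"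
      by (rule norm[OF *(3) gram_companion_norm[OF g]])
    moreover have "(q - (p \<bullet> g y) *\<^sub>R h y) \<bullet> (q - (p \<bullet> g y) *\<^sub>R h y) = 2"
      using norm[OF *(4) gram_companion_norm[OF h, of y]] W[OF y(1)] by simp
    moreover have "(p - (p \<bullet> g y) *\<^sub>R g y) \<bullet> g x = (q - (p \<bullet> g y) *\<^sub>R h y) \<bullet> h x \<and>
        (p - (p \<bullet> g y) *\<^sub>R g y) \<bullet> g x \<in> \<int>" if "x \<in> W" for x
      using W[OF that] W[OF y(1)] same[OF y(1) that] gram_companion_inner_Ints[OF g, of y x]
      by (auto simp: inner_diff_left intro!: Ints_diff Ints_mult)
    moreover have "(p - (p \<bullet> g y) *\<^sub>R g y) \<bullet> g v = (q - (p \<bullet> g y) *\<^sub>R h y) \<bullet> h v"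
      "1 \<le> \<bar>(p - (p \<bullet> g y) *\<^sub>R g y) \<bullet> g v\<bar>"
      using * y by (simp_all add: inner_diff_left)
    ultimately show ?thesis unfolding twin_roots_def by blast
  qed
  have "\<forall>p q. twin_roots W v g h p q \<longrightarrow> p \<bullet> g y \<noteq> 0 \<longrightarrow> False"
    using path
  proof (induction rule: converse_rtranclp_induct)
    case base
    show ?case using bad m by blast
  next
    case (step y z)
    then have yz: "y \<in> W" "z \<in> W" "g y \<bullet> g z \<noteq> 0" by auto
    have yv: "y \<noteq> v" using yz v by auto
    show ?case
    proof (intro allI impI)
      fix p q assume pq: "twin_roots W v g h p q" "p \<bullet> g y \<noteq> 0"
      have "\<bar>h y \<bullet> h v\<bar> = \<bar>g y \<bullet> g v\<bar>"
        using gram_companion_abs[OF g yv] gram_companion_abs[OF h yv] by simp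
      then consider "g y \<bullet> g v = 0" "h y \<bullet> h v = 0" | "g y \<bullet> g v \<noteq> 0" "h y \<bullet> h v = g y \<bullet> g v"
        | "g y \<bullet> g v \<noteq> 0" "h y \<bullet> h v = - (g y \<bullet> g v)" by linarith
      then show False
      proof cases
        case 1
        show False
        proof (cases "p \<bullet> g z = 0")
          case True
          then have "(p - (p \<bullet> g y) *\<^sub>R g y) \<bullet> g z \<noteq> 0" using pq yz by (simp add: inner_diff_left)
          then show False using step.IH twin_reflect[OF pq(1) yz(1) 1] by blast
        next
          case False
          then show False using step.IH pq by blast
        qed
      next
        case 2
        then show False using step.IH twin_basis[OF yz(1)] yz(3) by blast
      next
        case 3
        then show False using bad[OF pq(1) yz(1) pq(2)] by blast
      qed
    qed
  qed
  then show False using pq by blast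
qed

text \<open>The signs to be corrected are those of the connected components of the graph of
  \<open>B\<close> on \<open>W\<close> that contain a vertex at which \<open>v\<close> has the wrong
  sign. This works because a component cannot also contain a vertex at which \<open>v\<close> has the
  right nonzero sign: the basis vectors there would be twin roots.\<close>

lemma gram_companions_agree_on_extension:
  fixes g :: "'v::finite \<Rightarrow> 'a::real_inner" and h :: "'v \<Rightarrow> 'b::real_inner"
  assumes g: "gram_companion B g" and h: "gram_companion B h" and v: "v \<notin> W"
    and same: "\<And>x y. x \<in> W \<Longrightarrow> y \<in> W \<Longrightarrow> h x \<bullet> h y = g x \<bullet> g y"
  shows "\<exists>\<delta>. (\<forall>x. \<delta> x = 1 \<or> \<delta> x = (- 1 :: int)) \<and>
    (\<forall>x\<in>insert v W. \<forall>y\<in>insert v W. h x \<bullet> h y = real_of_int (\<delta> x * \<delta> y) * (g x \<bullet> g y))"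
proof -
  define R where "R x y \<longleftrightarrow> x \<in> W \<and> y \<in> W \<and> g x \<bullet> g y \<noteq> 0" for x y
  have R: "R = (\<lambda>x y. x \<in> W \<and> y \<in> W \<and> g x \<bullet> g y \<noteq> 0)" by (intro ext) (simp add: R_def)
  define bad where "bad m \<longleftrightarrow> m \<in> W \<and> g m \<bullet> g v \<noteq> 0 \<and> h m \<bullet> h v = - (g m \<bullet> g v)" for m
  define \<delta> :: "'v \<Rightarrow> int" where "\<delta> x = (if \<exists>m. R\<^sup>*\<^sup>* x m \<and> bad m then - 1 else 1)" for x
  have sign: "\<delta> x = 1 \<or> \<delta> x = - 1" for x by (simp add: \<delta>_def)
  have \<delta>_v: "\<delta> v = 1"
  proof -
    have "m = v" if "R\<^sup>*\<^sup>* v m" for m using that v by (cases rule: converse_rtranclpE) (simp_all add: R_def)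
    then show ?thesis using v by (auto simp: \<delta>_def bad_def)
  qed
  have \<delta>_step: "\<delta> x = \<delta> y" if "R x y" for x y
  proof -
    have "R y x" using that by (simp add: R_def inner_commute)
    then have "R\<^sup>*\<^sup>* x m \<longleftrightarrow> R\<^sup>*\<^sup>* y m" for m using that by (meson converse_rtranclp_into_rtranclp)
    then show ?thesis by (simp add: \<delta>_def)
  qed
  have sq: "\<delta> x * \<delta> x = 1" for x using sign[of x] by auto
  have WW: "h x \<bullet> h y = real_of_int (\<delta> x * \<delta> y) * (g x \<bullet> g y)" if "x \<in> W" "y \<in> W" for x y
  proof (cases "g x \<bullet> g y = 0")
    case False
    then have "\<delta> x = \<delta> y" using that by (intro \<delta>_step) (simp add: R_def)
    then show ?thesis using same[OF that] sq[of y] by simp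
  qed (use same[OF that] in simp)
  have Wv: "h x \<bullet> h v = real_of_int (\<delta> x * \<delta> v) * (g x \<bullet> g v)" if "x \<in> W" for x
  proof -
    have xv: "x \<noteq> v" using that v by auto
    have "\<bar>h x \<bullet> h v\<bar> = \<bar>g x \<bullet> g v\<bar>"
      using gram_companion_abs[OF g xv] gram_companion_abs[OF h xv] by simp
    then have "h x \<bullet> h v = g x \<bullet> g v \<or> h x \<bullet> h v = - (g x \<bullet> g v)" by linarith
    then consider "g x \<bullet> g v = 0" "h x \<bullet> h v = 0" | "g x \<bullet> g v \<noteq> 0" "h x \<bullet> h v = g x \<bullet> g v"
      | "bad x" "h x \<bullet> h v = - (g x \<bullet> g v)"
      using \<open>x \<in> W\<close> unfolding bad_def by (cases "g x \<bullet> g v = 0") auto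
    then show ?thesis
    proof cases
      case 2
      have "twin_roots W v g h (g x) (h x)"
        using that 2 same gram_companion_norm[OF g] gram_companion_norm[OF h]
          gram_companion_inner_Ints[OF g] Ints_nonzero_abs_ge1[where 'a = real]
        by (auto simp: twin_roots_def intro: span_base)
      moreover have "g x \<bullet> g x \<noteq> 0" using gram_companion_norm[OF g] by simp
      ultimately have "\<not> (R\<^sup>*\<^sup>* x m \<and> bad m)" for m
        using no_twin_roots_linked_to_bad[OF g h v same, of x m "g x" "h x"] unfolding R bad_def by blast
      then show ?thesis using 2 \<delta>_v by (simp add: \<delta>_def)
    next
      case 3
      then have "\<delta> x = - 1" unfolding \<delta>_def by auto
      then show ?thesis using 3 \<delta>_v by simp
    qed simp
  qed
  have "h x \<bullet> h y = real_of_int (\<delta> x * \<delta> y) * (g x \<bullet> g y)"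
    if xy: "x \<in> insert v W" "y \<in> insert v W" for x y
  proof -
    consider "x \<in> W" "y \<in> W" | "x \<in> W" "y = v" | "x = v" "y \<in> W" | "x = v" "y = v" using xy by blast
    then show ?thesis
    proof cases
      case 3
      then show ?thesis using Wv[of y] by (simp add: inner_commute mult.commute)
    next
      case 4
      then show ?thesis using \<delta>_v gram_companion_norm[OF g] gram_companion_norm[OF h] by simp
    qed (use WW Wv in auto)
  qed
  then show ?thesis using sign by blast
qed

theorem gram_companions_unique_up_to_signs:
  fixes g :: "'v::finite \<Rightarrow> 'a::real_inner" and h :: "'v \<Rightarrow> 'b::real_inner"
  assumes g: "gram_companion B g" and h: "gram_companion B h"
  shows "\<exists>\<epsilon>. (\<forall>x. \<epsilon> x = 1 \<or> \<epsilon> x = (- 1 :: int)) \<and>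
    (\<forall>x y. h x \<bullet> h y = real_of_int (\<epsilon> x * \<epsilon> y) * (g x \<bullet> g y))"
proof -
  have "\<exists>\<epsilon>. (\<forall>x. \<epsilon> x = 1 \<or> \<epsilon> x = (- 1 :: int)) \<and>
    (\<forall>x\<in>W. \<forall>y\<in>W. h x \<bullet> h y = real_of_int (\<epsilon> x * \<epsilon> y) * (g x \<bullet> g y))" if "finite W" for W
    using that
  proof (induction W)
    case empty
    show ?case by (rule exI[of _ "\<lambda>_. 1"]) simp
  next
    case (insert v W)
    then obtain \<epsilon> :: "'v \<Rightarrow> int" where sign: "\<And>x. \<epsilon> x = 1 \<or> \<epsilon> x = - 1"
      and W: "\<And>x y. x \<in> W \<Longrightarrow> y \<in> W \<Longrightarrow> h x \<bullet> h y = real_of_int (\<epsilon> x * \<epsilon> y) * (g x \<bullet> g y)"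
      by blast
    define g' where "g' x = real_of_int (\<epsilon> x) *\<^sub>R g x" for x
    have g': "gram_companion B g'" unfolding g'_def by (rule gram_companion_change_signs[OF g sign])
    have "h x \<bullet> h y = g' x \<bullet> g' y" if "x \<in> W" "y \<in> W" for x y
      using W[OF that] by (simp add: g'_def)
    from gram_companions_agree_on_extension[OF g' h insert.hyps(2) this]
    obtain \<delta> :: "'v \<Rightarrow> int" where \<delta>: "\<forall>x. \<delta> x = 1 \<or> \<delta> x = - 1"
      "\<forall>x\<in>insert v W. \<forall>y\<in>insert v W. h x \<bullet> h y = real_of_int (\<delta> x * \<delta> y) * (g' x \<bullet> g' y)"
      by blast
    have "\<delta> x * \<epsilon> x = 1 \<or> \<delta> x * \<epsilon> x = - 1" for x using sign[of x] \<delta>(1)[rule_format, of x] by auto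
    moreover have "\<forall>x\<in>insert v W. \<forall>y\<in>insert v W.
        h x \<bullet> h y = real_of_int ((\<delta> x * \<epsilon> x) * (\<delta> y * \<epsilon> y)) * (g x \<bullet> g y)"
      using \<delta>(2) by (simp add: g'_def mult_ac)
    ultimately show ?case by (intro exI[of _ "\<lambda>x. \<delta> x * \<epsilon> x"]) blast
  qed
  from this[of UNIV] show ?thesis by simp
qed

section \<open>The root lattice\<close>

lemma root_system_facts:
  assumes "normalised_root_system \<Phi>"
  shows "\<alpha> \<in> \<Phi> \<Longrightarrow> \<alpha> \<bullet> \<alpha> = 2" and "\<alpha> \<in> \<Phi> \<Longrightarrow> \<beta> \<in> \<Phi> \<Longrightarrow> \<beta> - (\<beta> \<bullet> \<alpha>) *\<^sub>R \<alpha> \<in> \<Phi>"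
    and "\<alpha> \<in> \<Phi> \<Longrightarrow> \<beta> \<in> \<Phi> \<Longrightarrow> \<beta> \<bullet> \<alpha> \<in> \<int>" and "\<alpha> \<in> \<Phi> \<Longrightarrow> - \<alpha> \<in> \<Phi>"
proof -
  show norm: "\<alpha> \<in> \<Phi> \<Longrightarrow> \<alpha> \<bullet> \<alpha> = 2" for \<alpha> using assms by (simp add: normalised_root_system_def)
  show refl: "\<alpha> \<in> \<Phi> \<Longrightarrow> \<beta> \<in> \<Phi> \<Longrightarrow> \<beta> - (\<beta> \<bullet> \<alpha>) *\<^sub>R \<alpha> \<in> \<Phi>" for \<alpha> \<beta>
    using assms by (simp add: normalised_root_system_def reflection_def)
  show "\<alpha> \<in> \<Phi> \<Longrightarrow> \<beta> \<in> \<Phi> \<Longrightarrow> \<beta> \<bullet> \<alpha> \<in> \<int>" using assms by (simp add: normalised_root_system_def)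
  assume "\<alpha> \<in> \<Phi>"
  moreover have "\<alpha> - 2 *\<^sub>R \<alpha> = - \<alpha>" by (simp add: scaleR_2)
  ultimately show "- \<alpha> \<in> \<Phi>" using refl[of \<alpha> \<alpha>] norm[of \<alpha>] by simp
qed

text \<open>Modulo 2 the square length is additive on vectors with integral inner product, and roots
  have square length 2. Integrality of the products with roots is proved along with it, as the
  induction needs it.\<close>

lemma root_lattice_even:
  assumes \<Phi>: "normalised_root_system \<Phi>" and "v \<in> int_module.span \<Phi>"
  shows "(\<exists>m. v \<bullet> v = 2 * real_of_int m) \<and> (\<forall>\<beta>\<in>\<Phi>. v \<bullet> \<beta> \<in> \<int>)"
  using assms(2)
proof (induction rule: int_module.span_induct_alt)
  case base
  show ?case by (auto intro: exI[of _ 0])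
next
  case (step c x y)
  then obtain m where m: "y \<bullet> y = 2 * real_of_int m" and Z: "\<forall>\<beta>\<in>\<Phi>. y \<bullet> \<beta> \<in> \<int>" by blast
  obtain i where i: "y \<bullet> x = real_of_int i" using Z step(1) by (auto elim: Ints_cases)
  have "(real_of_int c *\<^sub>R x + y) \<bullet> (real_of_int c *\<^sub>R x + y) = 2 * real_of_int (c * c + c * i + m)"
    using root_system_facts(1)[OF \<Phi> step(1)] m i
    by (simp add: inner_add_left inner_add_right inner_commute[of x y] algebra_simps)
  moreover have "(real_of_int c *\<^sub>R x + y) \<bullet> \<beta> \<in> \<int>" if "\<beta> \<in> \<Phi>" for \<beta>
    using root_system_facts(3)[OF \<Phi> that step(1)] Z that
    by (auto simp: inner_add_left intro!: Ints_add Ints_mult)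
  ultimately show ?case by blast
qed

lemma root_lattice_sum_list:
  assumes \<Phi>: "normalised_root_system \<Phi>" and "v \<in> int_module.span \<Phi>"
  shows "\<exists>xs. set xs \<subseteq> \<Phi> \<and> v = sum_list xs"
  using assms(2)
proof (induction rule: int_module.span_induct_alt)
  case base
  show ?case by (rule exI[of _ "[]"]) simp
next
  case (step c x y)
  then obtain ys where ys: "set ys \<subseteq> \<Phi>" "y = sum_list ys" by blast
  have rep: "sum_list (replicate n z) = real n *\<^sub>R z" for n and z :: 'a
    by (induction n) (simp_all add: algebra_simps)
  show ?case
  proof (cases "c \<ge> 0")
    case True
    then show ?thesis using ys step(1)
      by (intro exI[of _ "replicate (nat c) x @ ys"]) (auto simp: rep set_replicate_conv_if)
  next
    case False
    then show ?thesis using ys step(1) root_system_facts(4)[OF \<Phi>]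
      by (intro exI[of _ "replicate (nat (- c)) (- x) @ ys"]) (auto simp: rep set_replicate_conv_if)
  qed
qed

text \<open>A sum of square length 2 has positive inner product with some summand \<open>x\<close>.
  Either it equals \<open>x\<close>, or the inner product is 1 and removing \<open>x\<close> leaves a
  shorter sum of square length 2; this is a root by induction, and its reflection in \<open>x\<close>
  is the original sum.\<close>

lemma sum_list_root:
  assumes \<Phi>: "normalised_root_system \<Phi>"
  shows "set xs \<subseteq> \<Phi> \<Longrightarrow> sum_list xs \<bullet> sum_list xs = 2 \<Longrightarrow> sum_list xs \<in> \<Phi>"
proof (induction xs rule: measure_induct_rule[of length])
  case (less xs)
  define v where "v = sum_list xs"
  have inner: "v \<bullet> w = (\<Sum>x\<leftarrow>xs. x \<bullet> w)" for w
    unfolding v_def by (induction xs) (simp_all add: inner_add_left)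
  have "\<exists>x\<in>set xs. 0 < x \<bullet> v"
  proof (rule ccontr)
    assume "\<not> (\<exists>x\<in>set xs. 0 < x \<bullet> v)"
    then have "(\<Sum>x\<leftarrow>xs. x \<bullet> v) \<le> 0" by (intro sum_list_nonpos) (auto simp: not_less)
    then show False using inner[of v] less.prems by (simp add: v_def)
  qed
  then obtain x where x: "x \<in> set xs" "0 < x \<bullet> v" by blast
  have x\<Phi>: "x \<in> \<Phi>" using x less.prems by auto
  note xx = root_system_facts(1)[OF \<Phi> x\<Phi>]
  have v2: "v \<bullet> v = 2" using less.prems by (simp add: v_def)
  have v_eq: "v = x + sum_list (remove1 x xs)" unfolding v_def by (rule sum_list_map_remove1[OF x(1), of id, simplified])
  define w where "w = sum_list (remove1 x xs)"
  have "v \<in> int_module.span \<Phi>"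
    unfolding v_def using less.prems(1)
    by (induction xs) (auto intro: int_module.span_zero int_module.span_add int_module.span_base)
  then have "v \<bullet> x \<in> \<int>" using root_lattice_even[OF \<Phi>] x\<Phi> by blast
  then obtain i where i: "v \<bullet> x = real_of_int i" by (auto elim: Ints_cases)
  have norm: "(v - x) \<bullet> (v - x) = 4 - 2 * (v \<bullet> x)"
    using v2 xx by (simp add: inner_diff_left inner_diff_right inner_commute)
  have "i > 0" using x(2) i by (simp add: inner_commute)
  have "4 - 2 * (v \<bullet> x) \<ge> 0" unfolding norm[symmetric] by (rule inner_ge_zero)
  then have "i \<le> 2" using i by linarith
  consider "i = 1" | "i = 2" using \<open>i > 0\<close> \<open>i \<le> 2\<close> by linarith
  then show ?case
  proof cases
    case 2
    then have "v = x" using norm i by simp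
    then show ?thesis using x\<Phi> v_def by simp
  next
    case 1
    have w: "w = v - x" by (simp add: v_eq w_def)
    have "w \<bullet> w = 2" using norm i 1 by (simp add: w)
    moreover have "set (remove1 x xs) \<subseteq> \<Phi>" using less.prems(1) set_remove1_subset by fastforce
    ultimately have "w \<in> \<Phi>"
      unfolding w_def using less.IH[of "remove1 x xs"] x(1) length_pos_if_in_set[OF x(1)]
      by (simp add: length_remove1)
    moreover have "w \<bullet> x = - 1" using i 1 xx by (simp add: w inner_diff_left)
    ultimately have "w - (- 1) *\<^sub>R x \<in> \<Phi>" using root_system_facts(2)[OF \<Phi> x\<Phi>] by metis
    then show ?thesis by (simp add: w v_def)
  qed
qed

lemma root_lattice_norm_2:
  assumes "normalised_root_system \<Phi>" "v \<in> int_module.span \<Phi>" "v \<bullet> v = 2"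
  shows "v \<in> \<Phi>"
  using root_lattice_sum_list[OF assms(1,2)] sum_list_root[OF assms(1)] assms(3) by blast

section \<open>Companion bases\<close>

lemma inner_map_matrix:
  fixes \<gamma> :: "'v::finite \<Rightarrow> 'a::euclidean_space" and A :: "int ^ 'v ^ 'v"
  assumes "\<And>x y. real_of_int (A $ x $ y) = \<gamma> x \<bullet> \<gamma> y"
  shows "u \<bullet> (map_matrix real_of_int A *v u) = (\<Sum>x\<in>UNIV. u $ x *\<^sub>R \<gamma> x) \<bullet> (\<Sum>x\<in>UNIV. u $ x *\<^sub>R \<gamma> x)"
  by (simp add: inner_vec_def matrix_vector_mult_def map_matrix_def assms inner_sum_left
      inner_sum_right sum_distrib_left mult_ac inner_commute)

text \<open>Positive definiteness of the Gram matrix amounts to linear independence, over the reals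
  and hence over the integers.\<close>

lemma companion_basis_iff:
  fixes \<gamma> :: "'v::finite \<Rightarrow> 'a::euclidean_space"
  shows "companion_basis \<Phi> B \<gamma> \<longleftrightarrow> range \<gamma> \<subseteq> \<Phi> \<and>
    int_module.span (range \<gamma>) = int_module.span \<Phi> \<and> gram_companion B \<gamma>"
proof
  assume c: "companion_basis \<Phi> B \<gamma>"
  then obtain A where A: "\<And>x y. real_of_int (A $ x $ y) = \<gamma> x \<bullet> \<gamma> y"
    and q: "quasi_cartan_companion B A" and pos: "positive_matrix A"
    by (auto simp: companion_basis_def)
  have "c x = 0" if "(\<Sum>x\<in>UNIV. c x *\<^sub>R \<gamma> x) = 0" for c x
  proof -
    define u :: "real ^ 'v" where "u = (\<chi> x. c x)"
    have "u \<bullet> (map_matrix real_of_int A *v u) = 0"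
      using that by (simp add: inner_map_matrix[OF A] u_def)
    then have "u = 0" using pos unfolding positive_matrix_def by (metis less_irrefl)
    then show ?thesis by (simp add: u_def vec_eq_iff)
  qed
  moreover have "\<gamma> x \<bullet> \<gamma> x = 2" for x
    using q A[of x x] by (simp add: quasi_cartan_companion_def)
  moreover have "\<bar>\<gamma> x \<bullet> \<gamma> y\<bar> = \<bar>real_of_int (B $ x $ y)\<bar>" if "x \<noteq> y" for x y
  proof -
    have "\<bar>A $ x $ y\<bar> = \<bar>B $ x $ y\<bar>" using q that by (simp add: quasi_cartan_companion_def)
    then show ?thesis unfolding A[symmetric] by (metis of_int_abs)
  qed
  ultimately have "gram_companion B \<gamma>" unfolding gram_companion_def by blast
  with c show "range \<gamma> \<subseteq> \<Phi> \<and> int_module.span (range \<gamma>) = int_module.span \<Phi> \<and> gram_companion B \<gamma>"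
    by (simp add: companion_basis_def)
next
  assume *: "range \<gamma> \<subseteq> \<Phi> \<and> int_module.span (range \<gamma>) = int_module.span \<Phi> \<and> gram_companion B \<gamma>"
  then have g: "gram_companion B \<gamma>" by simp
  have inj: "inj \<gamma>" by (rule gram_companion_inj[OF g])
  have "int_module.independent (range \<gamma>)"
    unfolding int_module.dependent_explicit
  proof safe
    fix t u v assume t: "finite t" "t \<subseteq> range \<gamma>" "v \<in> t" "u v \<noteq> 0"
      and 0: "(\<Sum>v\<in>t. real_of_int (u v) *\<^sub>R v) = 0"
    have "(\<Sum>x\<in>UNIV. (if \<gamma> x \<in> t then real_of_int (u (\<gamma> x)) else 0) *\<^sub>R \<gamma> x)
        = (\<Sum>w\<in>range \<gamma>. (if w \<in> t then real_of_int (u w) else 0) *\<^sub>R w)"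
      by (simp add: sum.reindex[OF inj])
    also have "\<dots> = (\<Sum>v\<in>t. real_of_int (u v) *\<^sub>R v)"
      by (rule sum.mono_neutral_cong_right) (use t in auto)
    also note 0
    finally have z: "(if \<gamma> x \<in> t then real_of_int (u (\<gamma> x)) else 0) = 0" for x
      by (rule gram_companion_coeffs[OF g])
    obtain x where "v = \<gamma> x" using t by auto
    then show False using z[of x] t by simp
  qed
  moreover
  define A :: "int ^ 'v ^ 'v" where "A = (\<chi> x y. \<lfloor>\<gamma> x \<bullet> \<gamma> y\<rfloor>)"
  have A: "real_of_int (A $ x $ y) = \<gamma> x \<bullet> \<gamma> y" for x y
    using gram_companion_inner_Ints[OF g, of x y] by (simp add: A_def)
  have "quasi_cartan_companion B A"
    unfolding quasi_cartan_companion_def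
  proof (intro conjI allI impI)
    show "transpose A = A" by (simp add: transpose_def vec_eq_iff A_def inner_commute)
    show "A $ x $ x = 2" for x using gram_companion_norm[OF g] by (simp add: A_def)
    fix x y :: 'v assume "x \<noteq> y"
    then have "\<bar>real_of_int (A $ x $ y)\<bar> = \<bar>real_of_int (B $ x $ y)\<bar>"
      unfolding A by (rule gram_companion_abs[OF g])
    then show "\<bar>A $ x $ y\<bar> = \<bar>B $ x $ y\<bar>" by (metis of_int_abs of_int_eq_iff)
  qed
  moreover have "positive_matrix A"
    unfolding positive_matrix_def
  proof (intro allI impI)
    fix u :: "real ^ 'v" assume "u \<noteq> 0"
    then obtain x where "u $ x \<noteq> 0" by (auto simp: vec_eq_iff)
    then have "(\<Sum>x\<in>UNIV. u $ x *\<^sub>R \<gamma> x) \<noteq> 0" using gram_companion_coeffs[OF g, of "\<lambda>x. u $ x" x] by blast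
    then show "u \<bullet> (map_matrix real_of_int A *v u) > 0"
      unfolding inner_map_matrix[OF A] by simp
  qed
  ultimately show "companion_basis \<Phi> B \<gamma>"
    unfolding companion_basis_def using * inj A by blast
qed

lemma companion_basis_coords:
  fixes \<gamma> :: "'v::finite \<Rightarrow> 'a::euclidean_space"
  assumes c: "companion_basis \<Phi> B \<gamma>" and v: "v \<in> int_module.span \<Phi>"
  obtains c :: "'v \<Rightarrow> int" where "v = (\<Sum>x\<in>UNIV. real_of_int (c x) *\<^sub>R \<gamma> x)"
proof -
  have "v \<in> int_module.span (range \<gamma>)" using c v by (simp add: companion_basis_def)
  then obtain u :: "'a \<Rightarrow> int" where "v = (\<Sum>w\<in>range \<gamma>. real_of_int (u w) *\<^sub>R w)"
    using int_module.span_finite[of "range \<gamma>"] by auto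
  also have "\<dots> = (\<Sum>x\<in>UNIV. real_of_int (u (\<gamma> x)) *\<^sub>R \<gamma> x)"
    using c by (subst sum.reindex) (auto simp: companion_basis_def)
  finally show thesis by (rule that)
qed

lemma companion_basis_sum_in_lattice:
  assumes "companion_basis \<Phi> B \<gamma>"
  shows "(\<Sum>x\<in>X. real_of_int (c x) *\<^sub>R \<gamma> x) \<in> int_module.span \<Phi>"
proof (rule int_module.span_sum)
  fix x
  have "\<gamma> x \<in> \<Phi>" using assms by (auto simp: companion_basis_def)
  then show "real_of_int (c x) *\<^sub>R \<gamma> x \<in> int_module.span \<Phi>"
    by (intro int_module.span_scale int_module.span_base)
qed

lemma d_vector_sum:
  fixes \<gamma> :: "'v::finite \<Rightarrow> 'a::euclidean_space"
  assumes c: "companion_basis \<Phi> B \<gamma>"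
  shows "d_vector \<gamma> (\<Sum>x\<in>UNIV. real_of_int (c x) *\<^sub>R \<gamma> x) = (\<chi> x. \<bar>c x\<bar>)"
proof -
  let ?v = "\<Sum>x\<in>UNIV. real_of_int (c x) *\<^sub>R \<gamma> x"
  have inj: "inj \<gamma>" and ind: "int_module.independent (range \<gamma>)" using c by (auto simp: companion_basis_def)
  define f where "f w = (if w \<in> range \<gamma> then c (inv \<gamma> w) else 0)" for w
  have f: "f (\<gamma> x) = c x" for x using inj by (simp add: f_def)
  have sub: "{w. f w \<noteq> 0} \<subseteq> range \<gamma>" by (auto simp: f_def)
  have "int_module.representation (range \<gamma>) ?v = f"
  proof (rule int_module.representation_eqI[OF ind])
    show "?v \<in> int_module.span (range \<gamma>)"
      using companion_basis_sum_in_lattice[OF c] c by (simp add: companion_basis_def)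
    show "w \<in> range \<gamma>" if "f w \<noteq> 0" for w using that sub by auto
    show "finite {w. f w \<noteq> 0}" by (rule finite_subset[OF sub]) simp
    have "(\<Sum>w | f w \<noteq> 0. real_of_int (f w) *\<^sub>R w) = (\<Sum>w\<in>range \<gamma>. real_of_int (f w) *\<^sub>R w)"
      by (rule sum.mono_neutral_left) (use sub in auto)
    also have "\<dots> = ?v" using inj by (simp add: sum.reindex f)
    finally show "(\<Sum>w | f w \<noteq> 0. real_of_int (f w) *\<^sub>R w) = ?v" .
  qed
  then show ?thesis by (simp add: d_vector_def f)
qed

text \<open>Let \<open>p\<close> be the part of \<open>\<alpha>\<close> on which the coordinates of
  \<open>\<alpha>\<close> and \<open>\<beta>\<close> agree and \<open>q\<close> the part on which they
  are opposite, so that \<open>\<alpha> = p + q\<close> and \<open>\<beta> = p - q\<close>. Equality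
  of the square lengths gives \<open>p \<bullet> p + q \<bullet> q = 2\<close>, and since the root
  lattice is even, one of the parts is 0.\<close>

lemma d_vector_inj_up_to_sign:
  fixes \<gamma> :: "'v::finite \<Rightarrow> 'a::euclidean_space"
  assumes \<Phi>: "normalised_root_system \<Phi>" and c: "companion_basis \<Phi> B \<gamma>"
    and \<alpha>: "\<alpha> \<in> \<Phi>" and \<beta>: "\<beta> \<in> \<Phi>" and d: "d_vector \<gamma> \<alpha> = d_vector \<gamma> \<beta>"
  shows "\<alpha> = \<beta> \<or> \<alpha> = - \<beta>"
proof -
  obtain a :: "'v \<Rightarrow> int" where a: "\<alpha> = (\<Sum>x\<in>UNIV. real_of_int (a x) *\<^sub>R \<gamma> x)"
    by (rule companion_basis_coords[OF c int_module.span_base[OF \<alpha>]])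
  obtain b :: "'v \<Rightarrow> int" where b: "\<beta> = (\<Sum>x\<in>UNIV. real_of_int (b x) *\<^sub>R \<gamma> x)"
    by (rule companion_basis_coords[OF c int_module.span_base[OF \<beta>]])
  have abs: "\<bar>a x\<bar> = \<bar>b x\<bar>" for x using d unfolding a b d_vector_sum[OF c] by (simp add: vec_eq_iff)
  define P where "P = {x. a x = b x}"
  have off: "b x = - a x" if "x \<in> - P" for x using abs[of x] that by (auto simp: P_def)
  define p where "p = (\<Sum>x\<in>P. real_of_int (a x) *\<^sub>R \<gamma> x)"
  define q where "q = (\<Sum>x\<in>-P. real_of_int (a x) *\<^sub>R \<gamma> x)"
  have split: "(\<Sum>x\<in>UNIV. f x) = (\<Sum>x\<in>P. f x) + (\<Sum>x\<in>-P. f x)" for f :: "'v \<Rightarrow> 'a"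
    using sum.union_disjoint[of P "- P" f] by simp
  have \<alpha>_eq: "\<alpha> = p + q" unfolding a p_def q_def by (rule split)
  have "\<beta> = p + (\<Sum>x\<in>-P. real_of_int (b x) *\<^sub>R \<gamma> x)"
    unfolding b split p_def by (simp add: P_def)
  also have "(\<Sum>x\<in>-P. real_of_int (b x) *\<^sub>R \<gamma> x) = - q"
    unfolding q_def sum_negf[symmetric] by (rule sum.cong) (use off in auto)
  finally have \<beta>_eq: "\<beta> = p - q" by simp
  obtain m where m: "p \<bullet> p = 2 * real_of_int m"
    using root_lattice_even[OF \<Phi> companion_basis_sum_in_lattice[OF c]] unfolding p_def by blast
  obtain n where n: "q \<bullet> q = 2 * real_of_int n"
    using root_lattice_even[OF \<Phi> companion_basis_sum_in_lattice[OF c]] unfolding q_def by blast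
  have "(p + q) \<bullet> (p + q) = 2" "(p - q) \<bullet> (p - q) = 2"
    using root_system_facts(1)[OF \<Phi>] \<alpha> \<beta> \<alpha>_eq \<beta>_eq by simp_all
  then have "p \<bullet> p + q \<bullet> q = 2"
    by (simp add: inner_add_left inner_add_right inner_diff_left inner_diff_right inner_commute)
  then have "m + n = 1" using m n by linarith
  moreover have "0 \<le> m" "0 \<le> n" using inner_ge_zero[of p] inner_ge_zero[of q] m n by simp_all
  ultimately have "m = 0 \<or> n = 0" by linarith
  then have "p = 0 \<or> q = 0" using m n by auto
  then show ?thesis using \<alpha>_eq \<beta>_eq by auto
qed

lemma companion_basis_inward_mutation:
  fixes \<gamma> :: "'v::finite \<Rightarrow> 'a::euclidean_space"
  assumes \<Phi>: "normalised_root_system \<Phi>" and c: "companion_basis \<Phi> B \<gamma>"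
    and skew: "skew_symmetric B" and cyc: "cyclically_oriented B"
  shows "companion_basis \<Phi> (mutation k B) (inward_mutation B k \<gamma>)"
proof -
  let ?\<gamma> = "inward_mutation B k \<gamma>"
  have range: "range \<gamma> \<subseteq> \<Phi>" and span: "int_module.span (range \<gamma>) = int_module.span \<Phi>"
    and g: "gram_companion B \<gamma>" using c by (auto simp: companion_basis_iff)
  have "\<gamma> y \<in> \<Phi>" for y using range by blast
  then have "?\<gamma> x \<in> \<Phi>" for x
    using root_system_facts(2)[OF \<Phi>] by (simp add: inward_mutation_def reflection_def)
  then have range': "range ?\<gamma> \<subseteq> \<Phi>" by blast
  have k: "?\<gamma> k = \<gamma> k" using skew_diag[OF skew] by (simp add: inward_mutation_def quiver_def)
  have "\<gamma> x \<in> int_module.span (range ?\<gamma>)" for x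
  proof -
    obtain i where i: "\<gamma> x \<bullet> \<gamma> k = real_of_int i"
      using gram_companion_inner_Ints[OF g, of x k] by (auto elim: Ints_cases)
    have "\<gamma> x = ?\<gamma> x \<or> \<gamma> x = ?\<gamma> x + real_of_int i *\<^sub>R ?\<gamma> k"
      using i k by (simp add: inward_mutation_def reflection_def)
    moreover have "?\<gamma> y \<in> int_module.span (range ?\<gamma>)" for y by (rule int_module.span_base) simp
    ultimately show ?thesis by (metis int_module.span_add int_module.span_scale)
  qed
  then have "int_module.span (range \<gamma>) \<subseteq> int_module.span (range ?\<gamma>)"
    by (intro int_module.span_minimal int_module.subspace_span) auto
  moreover have "int_module.span (range ?\<gamma>) \<subseteq> int_module.span \<Phi>"
    by (rule int_module.span_mono[OF range'])
  ultimately show ?thesis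
    using range' span gram_companion_inward_mutation[OF g skew cyc] by (auto simp: companion_basis_iff)
qed

lemma d_vector_inward_mutation_sum:
  fixes \<gamma> :: "'v::finite \<Rightarrow> 'a::euclidean_space"
  assumes \<Phi>: "normalised_root_system \<Phi>" and c: "companion_basis \<Phi> B \<gamma>"
    and skew: "skew_symmetric B" and cyc: "cyclically_oriented B"
    and A: "\<And>x. \<gamma> x \<bullet> \<gamma> k = real_of_int (A x)"
  shows "d_vector (inward_mutation B k \<gamma>) (\<Sum>x\<in>UNIV. real_of_int (c x) *\<^sub>R \<gamma> x)
    = (\<chi> x. \<bar>if x = k then c k + (\<Sum>y | (y, k) \<in> quiver B. c y * A y) else c x\<bar>)"
proof -
  define c' where "c' x = (if x = k then c k + (\<Sum>y | (y, k) \<in> quiver B. c y * A y) else c x)" for x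
  have kk: "(k, k) \<notin> quiver B" using skew_diag[OF skew] by (simp add: quiver_def)
  have c'_in: "c' y = c y" if "(y, k) \<in> quiver B" for y using kk that by (auto simp: c'_def)
  have "(\<Sum>x\<in>UNIV. real_of_int (c' x) *\<^sub>R inward_mutation B k \<gamma> x)
    = (\<Sum>x\<in>UNIV. real_of_int (c x) *\<^sub>R \<gamma> x)"
    unfolding inward_mutation_sum
  proof (rule sum.cong)
    fix x
    have "(\<Sum>y | (y, k) \<in> quiver B. real_of_int (c' y) * (\<gamma> y \<bullet> \<gamma> k))
      = real_of_int (\<Sum>y | (y, k) \<in> quiver B. c y * A y)"
      by (simp add: c'_in A)
    then show "(real_of_int (c' x) - (if x = k then \<Sum>y | (y, k) \<in> quiver B. real_of_int (c' y) * (\<gamma> y \<bullet> \<gamma> k)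
        else 0)) *\<^sub>R \<gamma> x = real_of_int (c x) *\<^sub>R \<gamma> x"
      by (simp add: c'_def)
  qed simp
  then show ?thesis
    using d_vector_sum[OF companion_basis_inward_mutation[OF \<Phi> c skew cyc, of k], of c']
    by (simp add: c'_def)
qed

section \<open>Independence of the companion basis\<close>

lemma positive_roots_up_to_sign:
  assumes "simple_system \<Phi> S" "\<alpha> \<in> \<Phi>"
  shows "\<alpha> \<in> positive_roots \<Phi> S \<or> - \<alpha> \<in> positive_roots \<Phi> S"
  using assms by (simp add: simple_system_def)

lemma positive_roots_not_both:
  assumes "simple_system \<Phi> S" "\<alpha> \<in> positive_roots \<Phi> S" "- \<alpha> \<in> positive_roots \<Phi> S" "finite S"
  shows "\<alpha> = 0"
proof -
  obtain c d :: "'a \<Rightarrow> nat" where c: "\<alpha> = (\<Sum>b\<in>S. real (c b) *\<^sub>R b)" and d: "- \<alpha> = (\<Sum>b\<in>S. real (d b) *\<^sub>R b)"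
    using assms(2,3) by (auto simp: positive_roots_def)
  have "(\<Sum>b\<in>S. (real (c b) + real (d b)) *\<^sub>R b) = \<alpha> + - \<alpha>"
    unfolding c d by (simp add: scaleR_add_left sum.distrib flip: c d)
  then have "(\<Sum>b\<in>S. (real (c b) + real (d b)) *\<^sub>R b) = 0" by simp
  moreover have "independent S" using assms(1) by (simp add: simple_system_def)
  ultimately have "real (c b) + real (d b) = 0" if "b \<in> S" for b
    using independentD[of S S "\<lambda>b. real (c b) + real (d b)" b] assms(4) that by simp
  then have "c b = 0" if "b \<in> S" for b using that by fastforce
  then show ?thesis unfolding c by simp
qed

lemma d_vector_uminus:
  fixes \<gamma> :: "'v::finite \<Rightarrow> 'a::euclidean_space"
  assumes c: "companion_basis \<Phi> B \<gamma>" and \<alpha>: "\<alpha> \<in> \<Phi>"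
  shows "d_vector \<gamma> (- \<alpha>) = d_vector \<gamma> \<alpha>"
proof -
  have "int_module.independent (range \<gamma>)" "\<alpha> \<in> int_module.span (range \<gamma>)"
    using c int_module.span_base[OF \<alpha>] by (auto simp: companion_basis_def)
  then show ?thesis by (simp add: d_vector_def int_module.representation_neg)
qed

lemma inner_linear_combination:
  fixes v :: "'v::finite \<Rightarrow> 'a::real_inner"
  shows "(\<Sum>x\<in>UNIV. f x *\<^sub>R v x) \<bullet> (\<Sum>x\<in>UNIV. f x *\<^sub>R v x)
    = (\<Sum>x\<in>UNIV. \<Sum>y\<in>UNIV. f x * (f y * (v x \<bullet> v y)))"
  by (simp add: inner_sum_left inner_sum_right sum_distrib_left, subst sum.swap, simp add: mult.left_commute)

text \<open>The root \<open>\<beta>\<close> is the image of \<open>\<alpha>\<close>, up to sign,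
  under the isometry \<open>\<Psi> x \<mapsto> \<epsilon> x *\<^sub>R \<Omega> x\<close>. In the
  coordinate at \<open>k\<close> after mutation, the signs \<open>\<epsilon> y\<close> occur twice in
  each summand and cancel, and a common factor \<open>\<epsilon> k\<close> is left.\<close>

lemma d_vector_transfer:
  fixes \<Psi> \<Omega> :: "'v::finite \<Rightarrow> 'a::euclidean_space"
  assumes \<Phi>: "normalised_root_system \<Phi>" and S: "simple_system \<Phi> S"
    and skew: "skew_symmetric B" and cyc: "cyclically_oriented B"
    and \<Psi>: "companion_basis \<Phi> B \<Psi>" and \<Omega>: "companion_basis \<Phi> B \<Omega>"
    and \<alpha>: "\<alpha> \<in> positive_roots \<Phi> S"
  shows "\<exists>\<beta>\<in>positive_roots \<Phi> S. d_vector \<Omega> \<beta> = d_vector \<Psi> \<alpha> \<and>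
    d_vector (inward_mutation B k \<Omega>) \<beta> = d_vector (inward_mutation B k \<Psi>) \<alpha>"
proof -
  have g: "gram_companion B \<Psi>" and h: "gram_companion B \<Omega>"
    using \<Psi> \<Omega> by (auto simp: companion_basis_iff)
  obtain \<epsilon> :: "'v \<Rightarrow> int" where sign: "\<And>x. \<epsilon> x = 1 \<or> \<epsilon> x = - 1"
    and inner: "\<And>x y. \<Omega> x \<bullet> \<Omega> y = real_of_int (\<epsilon> x * \<epsilon> y) * (\<Psi> x \<bullet> \<Psi> y)"
    using gram_companions_unique_up_to_signs[OF g h] by blast
  have \<alpha>\<Phi>: "\<alpha> \<in> \<Phi>" using \<alpha> by (simp add: positive_roots_def)
  obtain c :: "'v \<Rightarrow> int" where c: "\<alpha> = (\<Sum>x\<in>UNIV. real_of_int (c x) *\<^sub>R \<Psi> x)"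
    by (rule companion_basis_coords[OF \<Psi> int_module.span_base[OF \<alpha>\<Phi>]])
  define \<beta> where "\<beta> = (\<Sum>x\<in>UNIV. real_of_int (c x * \<epsilon> x) *\<^sub>R \<Omega> x)"
  have sq: "\<epsilon> x * \<epsilon> x = 1" and abs: "\<bar>\<epsilon> x\<bar> = 1" for x using sign[of x] by auto
  have sq_real: "real_of_int (\<epsilon> x) * real_of_int (\<epsilon> x) = 1" for x
    using sq[of x] by (metis of_int_1 of_int_mult)
  have "\<beta> \<bullet> \<beta> = (\<Sum>x\<in>UNIV. \<Sum>y\<in>UNIV. real_of_int (c x * \<epsilon> x) * (real_of_int (c y * \<epsilon> y) * (\<Omega> x \<bullet> \<Omega> y)))"
    unfolding \<beta>_def by (rule inner_linear_combination)
  also have "\<dots> = (\<Sum>x\<in>UNIV. \<Sum>y\<in>UNIV. real_of_int (c x) * (real_of_int (c y) * (\<Psi> x \<bullet> \<Psi> y)))"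
  proof (intro sum.cong refl)
    fix x y
    have "real_of_int (c x * \<epsilon> x) * (real_of_int (c y * \<epsilon> y) * (\<Omega> x \<bullet> \<Omega> y))
      = (real_of_int (\<epsilon> x) * real_of_int (\<epsilon> x)) * (real_of_int (\<epsilon> y) * real_of_int (\<epsilon> y))
        * (real_of_int (c x) * (real_of_int (c y) * (\<Psi> x \<bullet> \<Psi> y)))"
      by (simp add: inner mult_ac)
    then show "real_of_int (c x * \<epsilon> x) * (real_of_int (c y * \<epsilon> y) * (\<Omega> x \<bullet> \<Omega> y))
      = real_of_int (c x) * (real_of_int (c y) * (\<Psi> x \<bullet> \<Psi> y))"
      by (simp add: sq_real)
  qed
  also have "\<dots> = \<alpha> \<bullet> \<alpha>"
    unfolding c by (rule inner_linear_combination[symmetric])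
  finally have "\<beta> \<bullet> \<beta> = 2" using root_system_facts(1)[OF \<Phi> \<alpha>\<Phi>] by simp
  then have \<beta>\<Phi>: "\<beta> \<in> \<Phi>"
    unfolding \<beta>_def by (intro root_lattice_norm_2[OF \<Phi> companion_basis_sum_in_lattice[OF \<Omega>]])
  have d: "d_vector \<Omega> \<beta> = d_vector \<Psi> \<alpha>"
    unfolding \<beta>_def c d_vector_sum[OF \<Omega>] d_vector_sum[OF \<Psi>] by (simp add: abs_mult abs)
  define A where "A x = \<lfloor>\<Psi> x \<bullet> \<Psi> k\<rfloor>" for x
  have A: "\<Psi> x \<bullet> \<Psi> k = real_of_int (A x)" for x
    using gram_companion_inner_Ints[OF g, of x k] by (simp add: A_def)
  have A': "\<Omega> x \<bullet> \<Omega> k = real_of_int (\<epsilon> x * \<epsilon> k * A x)" for x by (simp add: inner A)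
  have "(\<Sum>y | (y, k) \<in> quiver B. c y * \<epsilon> y * (\<epsilon> y * \<epsilon> k * A y))
      = \<epsilon> k * (\<Sum>y | (y, k) \<in> quiver B. c y * A y)"
    unfolding sum_distrib_left
  proof (rule sum.cong)
    fix y
    have "c y * \<epsilon> y * (\<epsilon> y * \<epsilon> k * A y) = (\<epsilon> y * \<epsilon> y) * (\<epsilon> k * (c y * A y))" by (simp add: mult_ac)
    then show "c y * \<epsilon> y * (\<epsilon> y * \<epsilon> k * A y) = \<epsilon> k * (c y * A y)" by (simp add: sq)
  qed simp
  then have "c k * \<epsilon> k + (\<Sum>y | (y, k) \<in> quiver B. c y * \<epsilon> y * (\<epsilon> y * \<epsilon> k * A y))
      = \<epsilon> k * (c k + (\<Sum>y | (y, k) \<in> quiver B. c y * A y))"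
    by (simp add: algebra_simps)
  then have abs_k: "\<bar>c k * \<epsilon> k + (\<Sum>y | (y, k) \<in> quiver B. c y * \<epsilon> y * (\<epsilon> y * \<epsilon> k * A y))\<bar>
      = \<bar>c k + (\<Sum>y | (y, k) \<in> quiver B. c y * A y)\<bar>"
    by (simp add: abs_mult abs)
  have d': "d_vector (inward_mutation B k \<Omega>) \<beta> = d_vector (inward_mutation B k \<Psi>) \<alpha>"
    unfolding \<beta>_def c d_vector_inward_mutation_sum[OF \<Phi> \<Omega> skew cyc A', of "\<lambda>x. c x * \<epsilon> x"]
      d_vector_inward_mutation_sum[OF \<Phi> \<Psi> skew cyc A]
    by (simp add: vec_eq_iff abs_k abs_mult abs)
  show ?thesis
    using positive_roots_up_to_sign[OF S \<beta>\<Phi>] d d' d_vector_uminus[OF \<Omega> \<beta>\<Phi>]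
      d_vector_uminus[OF companion_basis_inward_mutation[OF \<Phi> \<Omega> skew cyc, of k] \<beta>\<Phi>]
    by metis
qed

theorem theorem6p7:
  fixes \<Delta> :: dynkin
    and \<Phi> S :: "'a::euclidean_space set"
    and B :: "int ^ 'v ^ 'v::finite"
    and k :: 'v
    and \<Psi> \<Omega> :: "'v \<Rightarrow> 'a"
  assumes "valid_type \<Delta>"
    and "root_system_of_type \<Delta> \<Phi> S"
    and "exchange_matrix_of_type \<Delta> B"
    and "companion_basis \<Phi> B \<Psi>"
    and "companion_basis \<Phi> B \<Omega>"
  shows "phi_in \<Phi> S B k \<Psi> \<in> D_set \<Phi> S B \<rightarrow>\<^sub>E D_set \<Phi> S (mutation k B)
       \<and> phi_in \<Phi> S B k \<Psi> = phi_in \<Phi> S B k \<Omega>"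
proof -
  have \<Phi>: "normalised_root_system \<Phi>" and S: "simple_system \<Phi> S"
    using assms(2) by (auto simp: root_system_of_type_def)
  have skew: "skew_symmetric B" using assms(3) by (simp add: exchange_matrix_of_type_def)
  have cyc: "cyclically_oriented B"
    by (rule cyclically_oriented_of_exchange_matrix[OF assms(2,3)])
  note transfer = d_vector_transfer[OF \<Phi> S skew cyc]
  have "finite S" using S \<Phi> finite_subset by (auto simp: simple_system_def normalised_root_system_def)
  have uniq: "\<alpha> = \<beta>"
    if "companion_basis \<Phi> B \<gamma>" "\<alpha> \<in> positive_roots \<Phi> S" "\<beta> \<in> positive_roots \<Phi> S"
      "d_vector \<gamma> \<alpha> = d_vector \<gamma> \<beta>" for \<gamma> :: "'v \<Rightarrow> 'a" and \<alpha> \<beta>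
  proof (rule ccontr)
    have in\<Phi>: "\<alpha> \<in> \<Phi>" "\<beta> \<in> \<Phi>" using that by (auto simp: positive_roots_def)
    assume "\<alpha> \<noteq> \<beta>"
    then have "\<alpha> = - \<beta>" using d_vector_inj_up_to_sign[OF \<Phi> that(1) in\<Phi> that(4)] by blast
    then have "\<beta> = 0" using positive_roots_not_both[OF S that(3) _ \<open>finite S\<close>] that(2) by simp
    then show False using root_system_facts(1)[OF \<Phi> in\<Phi>(2)] by simp
  qed
  have phi: "phi_in \<Phi> S B k \<gamma> (d_vector \<gamma> \<alpha>) = d_vector (inward_mutation B k \<gamma>) \<alpha>"
    if \<gamma>: "companion_basis \<Phi> B \<gamma>" and \<alpha>: "\<alpha> \<in> positive_roots \<Phi> S" for \<gamma> :: "'v \<Rightarrow> 'a" and \<alpha>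
  proof -
    have "(THE \<beta>. \<beta> \<in> positive_roots \<Phi> S \<and> d_vector \<gamma> \<beta> = d_vector \<gamma> \<alpha>) = \<alpha>"
      by (rule the_equality) (use \<alpha> uniq[OF \<gamma>] in auto)
    moreover have "d_vector \<gamma> \<alpha> \<in> D_set \<Phi> S B" using \<gamma> \<alpha> by (auto simp: D_set_def)
    ultimately show ?thesis by (simp add: phi_in_def)
  qed
  have main: "phi_in \<Phi> S B k \<Psi> d = phi_in \<Phi> S B k \<Omega> d \<and> phi_in \<Phi> S B k \<Psi> d \<in> D_set \<Phi> S (mutation k B)"
    if "d \<in> D_set \<Phi> S B" for d
  proof -
    obtain \<gamma> \<delta> where \<gamma>: "companion_basis \<Phi> B \<gamma>" "\<delta> \<in> positive_roots \<Phi> S" "d = d_vector \<gamma> \<delta>"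
      using \<open>d \<in> D_set \<Phi> S B\<close> unfolding D_set_def by blast
    obtain \<alpha> where \<alpha>: "\<alpha> \<in> positive_roots \<Phi> S" "d_vector \<Psi> \<alpha> = d"
      using transfer[OF \<gamma>(1) assms(4) \<gamma>(2)] \<gamma>(3) by auto
    obtain \<beta> where \<beta>: "\<beta> \<in> positive_roots \<Phi> S" "d_vector \<Omega> \<beta> = d_vector \<Psi> \<alpha>"
      "d_vector (inward_mutation B k \<Omega>) \<beta> = d_vector (inward_mutation B k \<Psi>) \<alpha>"
      using transfer[OF assms(4,5) \<alpha>(1)] by blast
    have "phi_in \<Phi> S B k \<Psi> d = d_vector (inward_mutation B k \<Psi>) \<alpha>"
      using phi[OF assms(4) \<alpha>(1)] \<alpha>(2) by simp
    moreover have "phi_in \<Phi> S B k \<Omega> d = d_vector (inward_mutation B k \<Omega>) \<beta>"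
      using phi[OF assms(5) \<beta>(1)] \<beta>(2) \<alpha>(2) by simp
    moreover have "d_vector (inward_mutation B k \<Psi>) \<alpha> \<in> D_set \<Phi> S (mutation k B)"
      unfolding D_set_def using companion_basis_inward_mutation[OF \<Phi> assms(4) skew cyc, of k] \<alpha>(1) by auto
    ultimately show ?thesis using \<beta>(3) by simp
  qed
  have undef: "phi_in \<Phi> S B k \<gamma> d = undefined" if "d \<notin> D_set \<Phi> S B" for \<gamma> :: "'v \<Rightarrow> 'a" and d
    using that by (simp add: phi_in_def)
  show ?thesis
  proof
    show "phi_in \<Phi> S B k \<Psi> \<in> D_set \<Phi> S B \<rightarrow>\<^sub>E D_set \<Phi> S (mutation k B)"
      by (rule PiE_I) (use main undef in blast)+
    show "phi_in \<Phi> S B k \<Psi> = phi_in \<Phi> S B k \<Omega>"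
    proof
      fix d show "phi_in \<Phi> S B k \<Psi> d = phi_in \<Phi> S B k \<Omega> d"
        using main undef by (cases "d \<in> D_set \<Phi> S B") auto
    qed
  qed
qed

end
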